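(* Let $m,d\ge 0$ be integers and let $S_{m,d}(\mathcal{CH})$ be a sparse paving matroid of rank $d$ on $[m+d]$ with set of circuit-hyperplanes $\mathcal{CH}$. For every integer $i\ge 0$, the coefficient of $t^i$ in the Kazhdan--Lusztig polynomial of $S_{m,d}(\mathcal{CH})$ is at most the coefficient of $t^i$ in the Kazhdan--Lusztig polynomial of the uniform matroid $U_{m,d}$ of rank $d$ on $[m+d]$; that is, $c^i_{m,d}(\mathcal{CH})\le c^i_{m,d}(\emptyset)$.
   Context: $[n]=\{1,\dots,n\}$ and $\binom{[n]}{d}$ is the set of $d$-element subsets of $[n]$. Sparse paving matroids: a matroid $M$ of rank $d$ on the ground set $[m+d]$ with set of bases $\mathcal B\subseteq\binom{[m+d]}{d}$ is sparse paving if, with $\mathcal{CH}:=\binom{[m+d]}{d}\setminus\mathcal B$, any two distinct $C,C'\in\mathcal{CH}$ satisfy $|C\triangle C'|\ge 4$; then $\mathcal{CH}$ is exactly the set of circuit-hyperplanes of $M$. This matroid is denoted $S_{m,d}(\mathcal{CH})$; $S_{m,d}(\emptyset)=U_{m,d}$ is the uniform matroid of rank $d$ on $m+d$ elements. $c^i_{m,d}(\mathcal{CH})$ denotes the coefficient of $t^i$ in $P_{S_{m,d}(\mathcal{CH})}(t)$. Kazhdan--Lusztig polynomials: for a matroid $M$ with rank function $\operatorname{rk}$ and lattice of flats $L(M)$ with minimum $\hat 0$, the characteristic polynomial is $\chi_M(t)=\sum_{F\in L(M)}\mu_{L(M)}(\hat 0,F)\,t^{\operatorname{rk}M-\operatorname{rk}F}$,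 $\mu$ being the Möbius function. For a flat $F$, the localization $M^F$ is the matroid on $F$ whose independent sets are the subsets of $F$ independent in $M$; the contraction $M_F$ is the matroid on the complement of $F$ whose independent sets are the subsets whose union with a basis of $F$ is independent in $M$. The Kazhdan--Lusztig polynomials $P_M(t)\in\mathbb Z[t]$ are the unique family (known to exist, by Elias--Proudfoot--Wakefield) such that: (1) if $\operatorname{rk}M=0$ then $P_M(t)=1$; (2) if $\operatorname{rk}M>0$ then $\deg P_M(t)<\frac12\operatorname{rk}M$; (3) $t^{\operatorname{rk}M}P_M(t^{-1})=\sum_{F\text{ flat}}\chi_{M^F}(t)P_{M_F}(t)$. *)

theory Defs
  imports "HOL-Computational_Algebra.Polynomial"
begin

section \<open>Matroids\<close>

datatype 'a matroid = Matroid (ground: "'a set") (indep: "'a set set")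

definition is_matroid :: "'a matroid \<Rightarrow> bool" where
  "is_matroid M \<longleftrightarrow>
     finite (ground M) \<and>
     indep M \<subseteq> Pow (ground M) \<and>
     {} \<in> indep M \<and>
     (\<forall>I\<in>indep M. \<forall>J. J \<subseteq> I \<longrightarrow> J \<in> indep M) \<and>
     (\<forall>I\<in>indep M. \<forall>J\<in>indep M. card I < card J \<longrightarrow> (\<exists>x\<in>J - I. insert x I \<in> indep M))"

definition basis_of :: "'a matroid \<Rightarrow> 'a set \<Rightarrow> 'a set \<Rightarrow> bool" where
  "basis_of M X B \<longleftrightarrow>
     B \<in> indep M \<and> B \<subseteq> X \<and> (\<forall>I\<in>indep M. B \<subseteq> I \<longrightarrow> I \<subseteq> X \<longrightarrow> I = B)"

definition bases :: "'a matroid \<Rightarrow> 'a set set" where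
  "bases M = {B. basis_of M (ground M) B}"

definition rk :: "'a matroid \<Rightarrow> 'a set \<Rightarrow> nat" where
  "rk M X = Max (card ` {I \<in> indep M. I \<subseteq> X})"

abbreviation rank :: "'a matroid \<Rightarrow> nat" where
  "rank M \<equiv> rk M (ground M)"

definition flats :: "'a matroid \<Rightarrow> 'a set set" where
  "flats M = {F. F \<subseteq> ground M \<and> (\<forall>x\<in>ground M - F. rk M F < rk M (insert x F))}"

definition localization :: "'a matroid \<Rightarrow> 'a set \<Rightarrow> 'a matroid" where
  "localization M F = Matroid F {I \<in> indep M. I \<subseteq> F}"

definition contraction :: "'a matroid \<Rightarrow> 'a set \<Rightarrow> 'a matroid" where
  "contraction M F =
     Matroid (ground M - F) {I. I \<subseteq> ground M - F \<and> (\<exists>B. basis_of M F B \<and> I \<union> B \<in> indep M)}"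


section \<open>Characteristic and Kazhdan--Lusztig polynomials\<close>

text \<open>The Moebius function of the poset \<open>L\<close> of finite sets, ordered by inclusion. The test
  \<open>finite G\<close> only serves termination.\<close>

function mobius :: "'a set set \<Rightarrow> 'a set \<Rightarrow> 'a set \<Rightarrow> int" where
  "mobius L F G =
     (if F = G then 1
      else if finite G \<and> F \<subset> G then - (\<Sum>H\<in>{H \<in> L. F \<subseteq> H \<and> H \<subset> G}. mobius L F H)
      else 0)"
  by pat_completeness auto
termination
  by (relation "measure (\<lambda>(L, F, G). card G)") (auto intro: psubset_card_mono)

declare mobius.simps [simp del]

definition char_poly :: "'a matroid \<Rightarrow> int poly" where
  "char_poly M =
     (\<Sum>F\<in>flats M. monom (mobius (flats M) (LEAST F. F \<in> flats M) F) (rank M - rk M F))"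

text \<open>The polynomial \<open>t^r p(1/t)\<close>, for \<open>r\<close> at least the degree of \<open>p\<close>.\<close>

definition rev_poly :: "nat \<Rightarrow> int poly \<Rightarrow> int poly" where
  "rev_poly r p = monom 1 (r - degree p) * reflect_poly p"

lemma coeff_rev_poly:
  assumes "degree p \<le> r"
  shows "coeff (rev_poly r p) i = (if i \<le> r then coeff p (r - i) else 0)"
  using assms
  by (auto simp: rev_poly_def coeff_monom_mult coeff_reflect_poly coeff_eq_0)

definition KL_family :: "('a matroid \<Rightarrow> int poly) \<Rightarrow> bool" where
  "KL_family P \<longleftrightarrow>
     (\<forall>M. is_matroid M \<longrightarrow>
        (rank M = 0 \<longrightarrow> P M = 1) \<and>
        (rank M > 0 \<longrightarrow> 2 * degree (P M) < rank M) \<and>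
        rev_poly (rank M) (P M) =
          (\<Sum>F\<in>flats M. char_poly (localization M F) * P (contraction M F)))"

text \<open>The conditions determine \<open>P M\<close> for matroids \<open>M\<close> only, so the description is
  of the value at \<open>M\<close> and not of the function \<open>P\<close>.\<close>

definition KL_poly :: "'a matroid \<Rightarrow> int poly" where
  "KL_poly M = (THE p. \<exists>P. KL_family P \<and> p = P M)"


section \<open>Uniform and sparse paving matroids\<close>

definition uniform_matroid :: "nat \<Rightarrow> nat \<Rightarrow> nat matroid" where
  "uniform_matroid m d = Matroid {1..m + d} {I. I \<subseteq> {1..m + d} \<and> card I \<le> d}"

text \<open>\<open>M\<close> is the sparse paving matroid of rank \<open>d\<close> on \<open>{1..m + d}\<close> whose set of non-bases
  of size \<open>d\<close> (equivalently, of circuit-hyperplanes) is \<open>CH\<close>.\<close>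

definition sparse_paving :: "nat \<Rightarrow> nat \<Rightarrow> nat set set \<Rightarrow> nat matroid \<Rightarrow> bool" where
  "sparse_paving m d CH M \<longleftrightarrow>
     is_matroid M \<and> ground M = {1..m + d} \<and> rank M = d \<and>
     CH = {C. C \<subseteq> {1..m + d} \<and> card C = d} - bases M \<and>
     (\<forall>C\<in>CH. \<forall>C'\<in>CH. C \<noteq> C' \<longrightarrow> card ((C - C') \<union> (C' - C)) \<ge> 4)"

lemma uniform_matroid_is_matroid: "is_matroid (uniform_matroid m d)"
proof -
  have "\<exists>x\<in>J - I. insert x I \<subseteq> {1..m + d} \<and> card (insert x I) \<le> d"
    if "I \<subseteq> {1..m + d}" "J \<subseteq> {1..m + d}" "card J \<le> d" "card I < card J" for I J
  proof -
    have fin: "finite I" using that(1) by (rule finite_subset) simp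
    have "\<not> J \<subseteq> I" using card_mono[OF fin, of J] that(4) by linarith
    then obtain x where x: "x \<in> J" "x \<notin> I" by blast
    have "card (insert x I) \<le> d" using fin x that(3,4) by simp
    moreover have "insert x I \<subseteq> {1..m + d}" using x that(1,2) by blast
    ultimately show ?thesis using x by blast
  qed
  then have "\<forall>I\<in>indep (uniform_matroid m d). \<forall>J\<in>indep (uniform_matroid m d).
      card I < card J \<longrightarrow> (\<exists>x\<in>J - I. insert x I \<in> indep (uniform_matroid m d))"
    unfolding uniform_matroid_def matroid.sel mem_Collect_eq Ball_def by blast
  moreover have "card J \<le> d" if "I \<subseteq> {1..m + d}" "card I \<le> d" "J \<subseteq> I" for I J
  proof -
    have "finite I" using that(1) by (rule finite_subset) simp
    then show ?thesis using card_mono[of I J] that(2,3) by linarith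
  qed
  then have "\<forall>I\<in>indep (uniform_matroid m d). \<forall>J. J \<subseteq> I \<longrightarrow> J \<in> indep (uniform_matroid m d)"
    unfolding uniform_matroid_def matroid.sel mem_Collect_eq Ball_def by (meson order_trans)
  moreover have "finite (ground (uniform_matroid m d))" "{} \<in> indep (uniform_matroid m d)"
    "indep (uniform_matroid m d) \<subseteq> Pow (ground (uniform_matroid m d))"
    by (auto simp add: uniform_matroid_def)
  ultimately show ?thesis
    unfolding is_matroid_def by (intro conjI)
qed

lemma sparse_paving_uniform_matroid: "sparse_paving m d {} (uniform_matroid m d)"
proof -
  let ?I = "{I. I \<subseteq> {1..m + d} \<and> card I \<le> d}"
  have fin: "finite ?I" by (rule finite_subset[of _ "Pow {1..m + d}"]) auto
  have "{1..d} \<in> ?I" by simp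
  then have "d \<in> card ` ?I" by (rule rev_image_eqI) simp
  then have "Max (card ` ?I) = d"
    using fin by (intro Max_eqI) blast+
  moreover have "{I \<in> ?I. I \<subseteq> {1..m + d}} = ?I" by blast
  ultimately have "rank (uniform_matroid m d) = d"
    by (simp add: rk_def uniform_matroid_def)
  moreover have "C \<in> bases (uniform_matroid m d)" if "C \<subseteq> {1..m + d}" "card C = d" for C
  proof -
    have "J = C" if J: "J \<subseteq> {1..m + d}" "card J \<le> d" "C \<subseteq> J" for J
    proof -
      have "finite J" using J(1) by (rule finite_subset) simp
      then show ?thesis using card_seteq[of J C] J(2,3) \<open>card C = d\<close> by simp
    qed
    then show ?thesis
      using that unfolding bases_def basis_of_def uniform_matroid_def by simp
  qed
  then have "{C. C \<subseteq> {1..m + d} \<and> card C = d} - bases (uniform_matroid m d) = {}"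
    by blast
  moreover have "ground (uniform_matroid m d) = {1..m + d}"
    by (simp add: uniform_matroid_def)
  ultimately show ?thesis
    unfolding sparse_paving_def using uniform_matroid_is_matroid[of m d] by simp
qed

end

(* Write n for the number of circuit-hyperplanes. By induction on d (for d >= 2, m >= 1),
   P(U_{m,d}) - P(S_{m,d}(CH)) = n * q_d for a polynomial q_d that depends on d only: the defining
   recursions of the two polynomials have almost the same flats, and each circuit-hyperplane
   contributes the same amount to their difference. As deg q_d < d/2, the recursion determines q_d,
   so it suffices to exhibit a solution with nonnegative coefficients. Its coefficients are products
   of factorials. To verify the recursion, binomial inversion turns it into the palindromicity of
   sum_i (d choose i) t^i q_{d-i} + (d-1) t^(d-1), whose coefficients Vandermonde's identity
   evaluates to an expression that is visibly symmetric in k and d - k.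

   If no Kazhdan-Lusztig family existed, KL_poly would be the same junk value for all matroids,
   so existence need not be proved. *)

theory Submission
  imports Defs
begin

text \<open>The difference splits over the circuit-hyperplanes because two of them share no
  (d-1)-subset. Relaxing C, i.e. making it a basis, deletes the flat C and creates d new
  hyperplanes, the (d-1)-subsets of C; for different C these are different. A smaller flat F
  contributes through its contraction, whose circuit-hyperplanes come from the C that contain F.
  Exchanging the sums over F and C leaves for each C a sum over subsets of C, which depends on d
  alone.

  The term (d-1) t^(d-1) has the same origin. Let the Z-polynomial of M be the sum over the flats F
  of t^(rk F) P_(M_F). Relaxing one C changes it by exactly sum_i (d choose i) t^i q_(d-i) + (d-1)
  t^(d-1), since d hyperplanes take the place of one. Z-polynomials are palindromic, which suggests
  the identity to verify.

  The bound d >= 2 keeps {} a flat: a circuit-hyperplane of rank 1 would be a loop.\<close>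

section \<open>The polynomials measuring a relaxation\<close>

text \<open>The binomial transform with parameter x multiplies exponential generating functions by
  exp(x z), so parameters add under composition. The pair 1, -1 serves for inversion, the pair t, -1
  produces powers of t - 1.\<close>

lemma binomial_transform_compose:
  fixes x y :: "'a :: comm_ring_1"
  shows "(\<Sum>j\<le>d. of_nat (d choose j) * y ^ (d - j) * (\<Sum>i\<le>j. of_nat (j choose i) * x ^ (j - i) * b i))
       = (\<Sum>i\<le>d. of_nat (d choose i) * (x + y) ^ (d - i) * b i)"
proof -
  have inner: "(\<Sum>j=i..d. of_nat (d choose j) * of_nat (j choose i) * y ^ (d - j) * x ^ (j - i))
      = of_nat (d choose i) * (x + y) ^ (d - i)" if "i \<le> d" for i
  proof -
    have "(\<Sum>j=i..d. of_nat (d choose j) * of_nat (j choose i) * y ^ (d - j) * x ^ (j - i))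
        = (\<Sum>j=i..d. of_nat (d choose i) * (of_nat ((d - i) choose (j - i)) * x ^ (j - i) * y ^ (d - i - (j - i))))"
    proof (rule sum.cong)
      fix j assume "j \<in> {i..d}"
      then have "(d choose j) * (j choose i) = (d choose i) * ((d - i) choose (j - i))" "d - i - (j - i) = d - j"
        using choose_mult[of i j d] by auto
      then show "of_nat (d choose j) * of_nat (j choose i) * y ^ (d - j) * x ^ (j - i)
        = of_nat (d choose i) * (of_nat ((d - i) choose (j - i)) * x ^ (j - i) * y ^ (d - i - (j - i)))"
        by (metis (no_types, lifting) mult.assoc mult.commute of_nat_mult)
    qed simp
    also have "\<dots> = of_nat (d choose i) *
        (\<Sum>j=0+i..(d-i)+i. of_nat ((d - i) choose (j - i)) * x ^ (j - i) * y ^ (d - i - (j - i)))"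
      using that by (simp add: sum_distrib_left)
    also have "\<dots> = of_nat (d choose i) * (\<Sum>j\<le>d-i. of_nat ((d - i) choose j) * x ^ j * y ^ (d - i - j))"
      by (subst sum.shift_bounds_cl_nat_ivl) (simp add: atMost_atLeast0)
    finally show ?thesis by (simp add: binomial_ring)
  qed
  have "(\<Sum>j\<le>d. of_nat (d choose j) * y ^ (d - j) * (\<Sum>i\<le>j. of_nat (j choose i) * x ^ (j - i) * b i))
      = (\<Sum>j\<in>{..d}. \<Sum>i\<in>{i\<in>{..d}. i \<le> j}. of_nat (d choose j) * of_nat (j choose i) * y ^ (d - j) * x ^ (j - i) * b i)"
    by (intro sum.cong refl) (auto simp: sum_distrib_left mult_ac intro!: sum.cong)
  also have "\<dots> = (\<Sum>i\<in>{..d}. \<Sum>j\<in>{j\<in>{..d}. i \<le> j}. of_nat (d choose j) * of_nat (j choose i) * y ^ (d - j) * x ^ (j - i) * b i)"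
    by (rule sum.swap_restrict) auto
  also have "\<dots> = (\<Sum>i\<le>d. (\<Sum>j=i..d. of_nat (d choose j) * of_nat (j choose i) * y ^ (d - j) * x ^ (j - i)) * b i)"
    by (intro sum.cong refl) (auto simp: sum_distrib_right intro!: sum.cong)
  also have "\<dots> = (\<Sum>i\<le>d. of_nat (d choose i) * (x + y) ^ (d - i) * b i)"
    by (intro sum.cong refl) (simp add: inner)
  finally show ?thesis .
qed

text \<open>The coefficients of \<open>q\<^sub>d\<close>. For \<open>m = 1\<close> and a single circuit-hyperplane the matroid is
  \<open>U\<^bsub>1,d-1\<^esub>\<close> plus a coloop, so \<open>q\<^sub>d\<close> must be the difference of the Kazhdan--Lusztig polynomials of
  \<open>U\<^bsub>1,d\<^esub>\<close> and \<open>U\<^bsub>1,d-1\<^esub>\<close>, whose \<open>i\<close>-th coefficients are known to be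
  \<open>(d - i - 1 choose i) (d + 1 choose i) / (i + 1)\<close> and its analogue for \<open>d - 1\<close>.\<close>

definition relax_coeff :: "nat \<Rightarrow> nat \<Rightarrow> real" where
  "relax_coeff d i = (if 1 \<le> i \<and> 2 * i < d
     then 2 * fact d / (fact (i + 1) * fact (i - 1) * fact (d - 2 * i - 1) * real (d + 1 - i) * real (d - i - 1))
     else 0)"

lemma relax_coeff_nonneg: "0 \<le> relax_coeff d i"
  by (simp add: relax_coeff_def)

text \<open>On the left is the coefficient of t^k in sum_i (d choose i) t^i q_(d-i). With j = k - i,
  the two linear factors in the denominator of \<open>relax_coeff (l + j) j\<close> become l + 1 and
  l - 1, free of j; what remains is a product of two binomial coefficients, which Vandermonde's
  identity sums. The bound on l keeps l - 1 nonzero.\<close>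

lemma relax_coeff_binomial_sum:
  assumes k: "1 \<le> k" and l: "2 \<le> l" and d: "d = k + l"
  shows "(\<Sum>i\<le>k. real (d choose i) * relax_coeff (d - i) (k - i))
       = 2 * fact d * fact (d - 1) / (fact (k - 1) * fact (k + 1) * fact (l - 1) * fact (l + 1))"
proof -
  define c :: real where "c = 2 * fact d / (fact (k - 1) * fact l * (real l + 1) * (real l - 1))"
  have term_eq: "real (d choose (k - j)) * relax_coeff (d - (k - j)) j
       = (if 1 \<le> j \<and> j < l then c * (real ((k - 1) choose (j - 1)) * real (l choose (l - 1 - j))) else 0)"
    if "j \<le> k" for j
  proof (cases "1 \<le> j \<and> j < l")
    case True
    have 1: "real (d choose (k - j)) = fact d / (fact (k - j) * fact (l + j))"
      using that d by (subst binomial_fact) (auto simp: algebra_simps)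
    have 2: "d - (k - j) = l + j" using that d by simp
    have 3: "real ((k - 1) choose (j - 1)) = fact (k - 1) / (fact (j - 1) * fact (k - j))"
      using True that by (subst binomial_fact) auto
    have 4: "real (l choose (l - 1 - j)) = fact l / (fact (l - 1 - j) * fact (j + 1))"
      using True that by (subst binomial_fact) auto
    have 5: "real (l + j + 1 - j) = real l + 1" "real (l + j - j - 1) = real l - 1" "l + j - 2 * j - 1 = l - 1 - j"
      using l True by auto
    have "relax_coeff (l + j) j = 2 * fact (l + j) / (fact (j + 1) * fact (j - 1) * fact (l - 1 - j) * (real l + 1) * (real l - 1))"
      using True unfolding relax_coeff_def 5 by auto
    \<comment> \<open>Stated for real variables, so that cancellation treats each factorial as an
      atom.\<close>
    moreover have "u * v \<noteq> 0 \<Longrightarrow> a * b / (x * y) * (2 * y / (x1 * x2 * x3 * u * v))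
        = 2 * a * b / (w * z * u * v) * (w / (x2 * x) * (z / (x3 * x1)))"
      if "y \<noteq> 0" "w \<noteq> 0" "z \<noteq> 0" for a b u v w x y z x1 x2 x3 :: real
      using that by (simp add: field_simps)
    from this[of "fact (l + j)" "fact (k - 1)" "fact l" "real l + 1" "real l - 1" "fact d" 1]
    have "fact d / (fact (k - j) * fact (l + j)) * (2 * fact (l + j) / (fact (j + 1) * fact (j - 1) * fact (l - 1 - j) * (real l + 1) * (real l - 1)))
      = c * (fact (k - 1) / (fact (j - 1) * fact (k - j)) * (fact l / (fact (l - 1 - j) * fact (j + 1))))"
      unfolding c_def using l by (simp del: fact_Suc)
    ultimately show ?thesis using True unfolding 1 2 3 4 by simp
  next
    case False
    then have "relax_coeff (d - (k - j)) j = 0"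
      using that d unfolding relax_coeff_def by auto
    with False show ?thesis by auto
  qed
  have "(\<Sum>i\<le>k. real (d choose i) * relax_coeff (d - i) (k - i))
      = (\<Sum>j\<le>k. real (d choose (k - j)) * relax_coeff (d - (k - j)) j)"
    by (rule sum.reindex_bij_witness[where i = "\<lambda>j. k - j" and j = "\<lambda>j. k - j"]) auto
  also have "\<dots> = (\<Sum>j\<le>k. if 1 \<le> j \<and> j < l then c * (real ((k - 1) choose (j - 1)) * real (l choose (l - 1 - j))) else 0)"
    by (intro sum.cong refl term_eq) simp
  also have "\<dots> = (\<Sum>j\<in>{j. 1 \<le> j \<and> j < l \<and> j \<le> k}. c * (real ((k - 1) choose (j - 1)) * real (l choose (l - 1 - j))))"
    by (intro sum.mono_neutral_cong_right) auto
  also have "\<dots> = (\<Sum>j=1..<l. c * (real ((k - 1) choose (j - 1)) * real (l choose (l - 1 - j))))"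
    by (intro sum.mono_neutral_left) (use k in \<open>auto simp: binomial_eq_0\<close>)
  also have "\<dots> = (\<Sum>s\<le>l - 2. c * (real ((k - 1) choose s) * real (l choose (l - 2 - s))))"
    by (rule sum.reindex_bij_witness[where i = Suc and j = "\<lambda>j. j - 1"]) (use l in \<open>auto simp: numeral_2_eq_2\<close>)
  also have "\<dots> = c * real (\<Sum>s\<le>l - 2. ((k - 1) choose s) * (l choose (l - 2 - s)))"
    by (simp add: sum_distrib_left)
  also have "\<dots> = c * real ((d - 1) choose (l - 2))"
    unfolding vandermonde using d k by simp
  also have "real ((d - 1) choose (l - 2)) = fact (d - 1) / (fact (l - 2) * fact (k + 1))"
  proof -
    have "d - 1 - (l - 2) = k + 1" using d k l by simp
    then show ?thesis using d by (subst binomial_fact) auto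
  qed
  also have "c * \<dots> = 2 * fact d * fact (d - 1) / (fact (k - 1) * fact (k + 1) * fact (l - 1) * fact (l + 1))"
  proof -
    obtain n where n: "l = Suc (Suc n)" using l by (metis Suc_le_D numeral_2_eq_2 Suc_le_mono)
    show ?thesis unfolding c_def n by (simp add: field_simps)
  qed
  finally show ?thesis .
qed


section \<open>Reversal of polynomials at a fixed degree bound\<close>

text \<open>Unlike \<open>rev_poly\<close>, this reversal does not mention the degree of \<open>p\<close> and so is linear in \<open>p\<close>.\<close>

definition rev_bound :: "nat \<Rightarrow> 'a::comm_ring_1 poly \<Rightarrow> 'a poly" where
  "rev_bound r p = (\<Sum>i\<le>r. monom (coeff p (r - i)) i)"

lemma coeff_rev_bound: "coeff (rev_bound r p) k = (if k \<le> r then coeff p (r - k) else 0)"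
  by (simp add: rev_bound_def coeff_sum)

lemma rev_bound_add: "rev_bound r (p + q) = rev_bound r p + rev_bound r q"
  and rev_bound_diff: "rev_bound r (p - q) = rev_bound r p - rev_bound r q"
  and rev_bound_smult: "rev_bound r (smult c p) = smult c (rev_bound r p)"
  by (rule poly_eqI; simp add: coeff_rev_bound)+

lemma rev_bound_0: "rev_bound r 0 = 0"
  by (simp add: rev_bound_def)

lemma rev_bound_sum: "rev_bound r (sum f A) = (\<Sum>x\<in>A. rev_bound r (f x))"
  by (induction A rule: infinite_finite_induct) (simp_all add: rev_bound_add rev_bound_0)

text \<open>The coefficients at k and r - k agree, and one of these indices is at least r/2. This is
  how the degree bound makes solutions of the recursion unique.\<close>

lemma rev_bound_fixed_imp_zero:
  assumes "rev_bound r p = p" "\<And>k. r \<le> 2 * k \<Longrightarrow> coeff p k = 0"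
  shows "p = 0"
proof (rule poly_eqI)
  fix k
  have "coeff p k = coeff (rev_bound r p) k" using assms(1) by simp
  then show "coeff p k = coeff 0 k"
    using assms(2)[of k] assms(2)[of "r - k"] by (cases "r \<le> 2 * k") (auto simp: coeff_rev_bound split: if_splits)
qed

definition relax_poly :: "nat \<Rightarrow> real poly" where
  "relax_poly d = (\<Sum>i\<le>d. monom (relax_coeff d i) i)"

lemma coeff_relax_poly: "coeff (relax_poly d) i = relax_coeff d i"
  by (simp add: relax_poly_def coeff_sum relax_coeff_def)

lemma relax_poly_eq_0: "d \<le> 2 \<Longrightarrow> relax_poly d = 0"
  by (rule poly_eqI) (auto simp: coeff_relax_poly relax_coeff_def)

text \<open>\<open>W\<close> is the change of the Z-polynomial per relaxed circuit-hyperplane. Its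
  sum has no term of degree d - 1, while for d >= 3 its coefficient at t is d - 1 by
  \<open>relax_coeff_binomial_sum\<close>; the extra monomial supplies the mirror image.\<close>

lemma relax_Z_palindromic:
  fixes d :: nat
  defines "W \<equiv> (\<Sum>i\<le>d. of_nat (d choose i) * monom 1 i * relax_poly (d - i)) + monom (real (d - 1)) (d - 1)"
  shows "rev_bound d W = W"
proof -
  define z where "z k = (if 1 \<le> k \<and> k < d then
      2 * fact d * fact (d - 1) / (fact (k - 1) * fact (k + 1) * fact (d - k - 1) * fact (d - k + 1)) else 0 :: real)" for k
  have coeff_W: "coeff W k = z k" for k
  proof -
    have c: "coeff W k = (\<Sum>i\<le>d. real (d choose i) * (if i \<le> k then relax_coeff (d - i) (k - i) else 0)) + (if k = d - 1 then real (d - 1) else 0)"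
    proof -
      have "coeff (of_nat n * (monom 1 i * p)) k = real n * (if i \<le> k then coeff p (k - i) else 0)" for n i p
        by (simp add: of_nat_poly coeff_monom_mult)
      then show ?thesis unfolding W_def by (simp add: coeff_sum coeff_relax_poly mult.assoc cong: if_cong)
    qed
    have s: "(\<Sum>i\<le>d. real (d choose i) * (if i \<le> k then relax_coeff (d - i) (k - i) else 0))
           = (\<Sum>i\<le>k. real (d choose i) * relax_coeff (d - i) (k - i))" if "k \<le> d"
      using that by (intro sum.mono_neutral_cong_right) auto
    consider "1 \<le> k" "k + 2 \<le> d" | "k = 0" | "1 \<le> k" "d = k + 1" | "d \<le> k" "1 \<le> k" by linarith
    then show ?thesis
    proof cases
      case 1
      then show ?thesis using c s relax_coeff_binomial_sum[of k "d - k" d] unfolding z_def by auto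
    next
      case 2
      then show ?thesis using c s by (simp add: z_def relax_coeff_def)
    next
      case 3
      have "relax_coeff (d - i) (k - i) = 0" for i using 3 by (auto simp: relax_coeff_def)
      moreover have "z k = real k"
      proof -
        obtain n where n: "k = Suc n" using 3 by (cases k) auto
        have "2 * (a * (b * (c * e))) * (b * e) / (e * (a * (b * (c * e))) * 2) = b" if "a \<noteq> 0" "b \<noteq> 0" "c \<noteq> 0" "e \<noteq> 0" for a b c e :: real
          using that by simp
        from this[of "real n + 3" "real n + 1" "real n + 2" "fact n"] show ?thesis using 3 unfolding z_def n
          by (simp add: mult_ac add_ac)
      qed
      ultimately show ?thesis using c s 3 by simp
    next
      case 4
      have "relax_coeff (d - i) (k - i) = 0" if "i \<le> d" for i using 4 that by (auto simp: relax_coeff_def)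
      moreover have "(if k = d - 1 then real (d - 1) else 0) = 0" using 4 by auto
      ultimately show ?thesis using c 4 by (auto simp: z_def intro!: sum.neutral)
    qed
  qed
  have "z (d - k) = z k" if "k \<le> d" for k
    using that unfolding z_def by (auto simp: mult_ac)
  then show ?thesis
    by (intro poly_eqI) (auto simp: coeff_rev_bound coeff_W z_def)
qed

text \<open>Palindromicity in the form used for inversion: reversing t^i q_(d-i) at the bound d
  absorbs the power of t and leaves the reversal of q_(d-i) at the bound d - i. The two monomials
  are the extra term of \<open>W\<close> and its mirror image.\<close>

lemma relax_poly_rev_binomial:
  assumes "1 \<le> d"
  shows "(\<Sum>i\<le>d. of_nat (d choose i) * rev_bound (d - i) (relax_poly (d - i)))
       = (\<Sum>i\<le>d. of_nat (d choose i) * monom 1 i * relax_poly (d - i)) + of_nat (d - 1) * (monom 1 (d - 1) - monom 1 1)"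
proof -
  define A where "A = (\<Sum>i\<le>d. of_nat (d choose i) * monom 1 i * relax_poly (d - i))"
  have "rev_bound d (of_nat n * monom 1 i * p) = of_nat n * rev_bound (d - i) p" if "i \<le> d" for n i and p :: "real poly"
  proof (rule poly_eqI)
    fix k
    have "coeff (rev_bound d (of_nat n * (monom 1 i * p))) k = coeff (of_nat n * rev_bound (d - i) p) k"
      using that diff_commute[of d k i] by (auto simp: coeff_rev_bound coeff_monom_mult of_nat_poly)
    then show "coeff (rev_bound d (of_nat n * monom 1 i * p)) k = coeff (of_nat n * rev_bound (d - i) p) k"
      by (simp add: mult.assoc)
  qed
  then have "rev_bound d A = (\<Sum>i\<le>d. of_nat (d choose i) * rev_bound (d - i) (relax_poly (d - i)))"
    unfolding A_def rev_bound_sum by (intro sum.cong refl) auto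
  moreover have "rev_bound d (monom (real (d - 1)) (d - 1)) = monom (real (d - 1)) 1"
    using assms by (intro poly_eqI) (auto simp: coeff_rev_bound)
  moreover have "rev_bound d (A + monom (real (d - 1)) (d - 1)) = A + monom (real (d - 1)) (d - 1)"
    unfolding A_def by (rule relax_Z_palindromic)
  moreover have "of_nat n * monom 1 j = monom (real n) j" for n j
    by (simp add: of_nat_poly smult_monom)
  ultimately show ?thesis
    unfolding A_def[symmetric] by (simp add: rev_bound_add right_diff_distrib add_diff_eq eq_diff_eq add.commute)
qed

section \<open>Alternating binomial sums and the recursion for \<open>relax_poly\<close>\<close>

lemma sum_alternating_binomial_power:
  fixes x :: "'a::comm_ring_1"
  shows "(\<Sum>j\<le>d. of_nat (d choose j) * (- 1) ^ (d - j) * x ^ j) = (x - 1) ^ d"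
  using binomial_ring[of x "- 1" d] by (simp add: mult_ac)

text \<open>This is x times the derivative of the previous identity; absorbing j into the binomial
  coefficient replaces differentiation.\<close>

lemma sum_alternating_binomial_linear:
  fixes x :: "'a::comm_ring_1"
  assumes "1 \<le> d"
  shows "(\<Sum>j\<le>d. of_nat (d choose j) * (- 1) ^ (d - j) * (of_nat j * x ^ j)) = of_nat d * x * (x - 1) ^ (d - 1)"
proof -
  obtain n where n: "d = Suc n" using assms by (cases d) auto
  have "(\<Sum>j\<le>d. of_nat (d choose j) * (- 1) ^ (d - j) * (of_nat j * x ^ j))
      = (\<Sum>j\<le>n. of_nat (Suc n choose Suc j) * (- 1) ^ (n - j) * (of_nat (Suc j) * x ^ Suc j))"
    unfolding n by (subst sum.atMost_Suc_shift) simp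
  also have "\<dots> = (\<Sum>j\<le>n. of_nat (Suc n) * x * (of_nat (n choose j) * (- 1) ^ (n - j) * x ^ j))"
  proof (intro sum.cong refl)
    fix j
    have "of_nat (Suc n choose Suc j) * of_nat (Suc j) = (of_nat (Suc n) * of_nat (n choose j) :: 'a)"
      using Suc_times_binomial_eq[of n j] by (metis of_nat_mult)
    then show "of_nat (Suc n choose Suc j) * (- 1) ^ (n - j) * (of_nat (Suc j) * x ^ Suc j)
      = of_nat (Suc n) * x * (of_nat (n choose j) * (- 1) ^ (n - j) * x ^ j)"
      by (metis (no_types, lifting) mult.assoc mult.left_commute power_Suc)
  qed
  also have "\<dots> = of_nat (Suc n) * x * (x - 1) ^ n"
    unfolding sum_distrib_left[symmetric] sum_alternating_binomial_power ..
  finally show ?thesis using n by simp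
qed

text \<open>What one circuit-hyperplane C contributes to the difference of the two Kazhdan--Lusztig
  recursions: the sum comes from the subsets of C, the next term from its d subsets of size d - 1,
  \<chi> from the lost flat C, and the last term from the changed characteristic polynomial of the
  whole matroid. The hypothesis describes \<chi> as the characteristic polynomial of a circuit with
  d elements. The formula results from inverting the binomial transform in
  \<open>relax_poly_rev_binomial\<close>.\<close>

lemma relax_poly_recursion:
  fixes \<chi> :: "real poly"
  assumes d: "2 \<le> d" and \<chi>: "[:0, 1:] * \<chi> = [:-1, 1:] ^ d + (- 1) ^ d * [:-1, 1:]"
  shows "rev_bound d (relax_poly d) = (\<Sum>i\<le>d. of_nat (d choose i) * [:-1, 1:] ^ i * relax_poly (d - i))
       + of_nat d * [:-1, 1:] ^ (d - 1) - \<chi> + (- 1) ^ (d - 1) * [:-1, 1:]"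
proof -
  define t :: "real poly" where "t = [:0, 1:]"
  have t1: "[:-1, 1:] = t - 1" by (simp add: t_def one_pCons)
  have mt: "monom 1 i = t ^ i" for i by (simp add: t_def monom_altdef)
  \<comment> \<open>Truncated subtraction makes g 0 = 0, so that \<open>rev\<close> holds at j = 0
    too, where \<open>relax_poly_rev_binomial\<close> does not apply.\<close>
  define g where "g j = of_nat (j - 1) * (t ^ (j - 1) - t)" for j
  have rev: "(\<Sum>i\<le>j. of_nat (j choose i) * 1 ^ (j - i) * rev_bound i (relax_poly i))
        = (\<Sum>i\<le>j. of_nat (j choose i) * t ^ (j - i) * relax_poly i) + g j" for j
  proof -
    have reflect: "(\<Sum>i\<le>j. f i) = (\<Sum>i\<le>j. f (j - i))" for f :: "nat \<Rightarrow> real poly"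
      by (rule sum.reindex_bij_witness[where i = "\<lambda>i. j - i" and j = "\<lambda>i. j - i"]) auto
    show ?thesis
    proof (cases "j = 0")
      case True
      then show ?thesis by (simp add: relax_poly_eq_0 rev_bound_0 g_def)
    next
      case False
      have "(\<Sum>i\<le>j. of_nat (j choose i) * 1 ^ (j - i) * rev_bound i (relax_poly i))
        = (\<Sum>i\<le>j. of_nat (j choose i) * rev_bound (j - i) (relax_poly (j - i)))"
        by (subst reflect) (auto intro!: sum.cong simp: binomial_symmetric[symmetric])
      also have "\<dots> = (\<Sum>i\<le>j. of_nat (j choose i) * t ^ i * relax_poly (j - i)) + g j"
        using relax_poly_rev_binomial[of j] False by (simp add: mt g_def)
      also have "(\<Sum>i\<le>j. of_nat (j choose i) * t ^ i * relax_poly (j - i))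
         = (\<Sum>i\<le>j. of_nat (j choose i) * t ^ (j - i) * relax_poly i)"
        by (subst reflect) (auto intro!: sum.cong simp: binomial_symmetric[symmetric])
      finally show ?thesis .
    qed
  qed
  \<comment> \<open>The transform with parameter 1 + (-1) = 0 is the identity, as 0^0 = 1. Splitting
    it into parameter -1 after parameter 1 lets \<open>rev\<close> act in between; -1 after t then
    gives the powers of t - 1.\<close>
  have "rev_bound d (relax_poly d) = (\<Sum>i\<le>d. of_nat (d choose i) * (1 + - 1) ^ (d - i) * rev_bound i (relax_poly i))"
  proof -
    have "(\<Sum>i\<le>d. of_nat (d choose i) * (1 + - 1) ^ (d - i) * rev_bound i (relax_poly i))
        = (\<Sum>i\<in>{d}. of_nat (d choose i) * (1 + - 1) ^ (d - i) * rev_bound i (relax_poly i))"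
      by (rule sum.mono_neutral_right) auto
    then show ?thesis by simp
  qed
  also have "\<dots> = (\<Sum>j\<le>d. of_nat (d choose j) * (- 1) ^ (d - j) *
       ((\<Sum>i\<le>j. of_nat (j choose i) * t ^ (j - i) * relax_poly i) + g j))"
    unfolding binomial_transform_compose[symmetric] rev ..
  also have "\<dots> = (\<Sum>i\<le>d. of_nat (d choose i) * (t + - 1) ^ (d - i) * relax_poly i)
       + (\<Sum>j\<le>d. of_nat (d choose j) * (- 1) ^ (d - j) * g j)"
    unfolding binomial_transform_compose[symmetric] by (simp add: algebra_simps sum.distrib)
  also have "(\<Sum>i\<le>d. of_nat (d choose i) * (t + - 1) ^ (d - i) * relax_poly i)
      = (\<Sum>i\<le>d. of_nat (d choose i) * (t - 1) ^ i * relax_poly (d - i))"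
    by (rule sum.reindex_bij_witness[where i = "\<lambda>i. d - i" and j = "\<lambda>i. d - i"])
      (auto simp: binomial_symmetric[symmetric])
  also have "(\<Sum>j\<le>d. of_nat (d choose j) * (- 1) ^ (d - j) * g j)
      = of_nat d * (t - 1) ^ (d - 1) - \<chi> + (- 1) ^ (d - 1) * (t - 1)" (is "?G = ?H")
  proof -
    let ?s = "\<lambda>j. of_nat (d choose j) * (- 1) ^ (d - j) :: real poly"
    \<comment> \<open>Multiplying by t turns t^(j-1) into t^j, which the alternating sums can
      evaluate. The last summand corrects j = 0, where \<open>j - 1\<close> is truncated.\<close>
    have tg: "t * g j = of_nat j * t ^ j - t ^ j - (of_nat j - 1) * t\<^sup>2 + (if j = 0 then 1 - t\<^sup>2 else 0)" for j
    proof (cases j)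
      case (Suc n)
      then show ?thesis by (simp add: g_def algebra_simps power2_eq_square)
    qed (simp add: g_def)
    then have "t * ?G = (\<Sum>j\<le>d. ?s j * (of_nat j * t ^ j) - ?s j * t ^ j
        - (?s j * (of_nat j * 1 ^ j) - ?s j * 1 ^ j) * t\<^sup>2 + (if j = 0 then ?s j * (1 - t\<^sup>2) else 0))"
      unfolding sum_distrib_left
    proof (intro sum.cong refl)
      fix j
      have "t * (?s j * g j) = ?s j * (t * g j)" by (simp only: mult_ac)
      also have "\<dots> = ?s j * (of_nat j * t ^ j - t ^ j - (of_nat j - 1) * t\<^sup>2 + (if j = 0 then 1 - t\<^sup>2 else 0))"
        by (simp only: tg)
      also have "\<dots> = ?s j * (of_nat j * t ^ j) - ?s j * t ^ j
        - (?s j * (of_nat j * 1 ^ j) - ?s j * 1 ^ j) * t\<^sup>2 + (if j = 0 then ?s j * (1 - t\<^sup>2) else 0)"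
        by (cases "j = 0") (simp_all add: algebra_simps)
      finally show "t * (?s j * g j) = \<dots>" .
    qed
    also have "\<dots> = of_nat d * t * (t - 1) ^ (d - 1) - (t - 1) ^ d
        - (of_nat d * 1 * (1 - 1) ^ (d - 1) - (1 - 1) ^ d) * t\<^sup>2 + (- 1) ^ d * (1 - t\<^sup>2)"
      unfolding sum.distrib sum_subtractf sum_distrib_right[symmetric]
      using d by (subst (1 2) sum_alternating_binomial_power, subst (1 2) sum_alternating_binomial_linear) simp_all
    also have "\<dots> = t * ?H"
    proof -
      obtain n where n: "d = Suc (Suc n)" using d by (metis Suc_le_D numeral_2_eq_2 Suc_le_mono)
      have "t * ?H = of_nat d * t * (t - 1) ^ (d - 1) - t * \<chi> + (- 1) ^ (d - 1) * t * (t - 1)"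
        by (simp add: algebra_simps)
      also have "t * \<chi> = (t - 1) ^ d + (- 1) ^ d * (t - 1)"
        using \<chi> unfolding t1 by (simp add: t_def)
      finally show ?thesis unfolding n by (simp add: algebra_simps power2_eq_square)
    qed
    finally have "t * ?G = t * ?H" .
    moreover have "t \<noteq> 0" by (simp add: t_def)
    ultimately show ?thesis by simp
  qed
  finally show ?thesis unfolding t1 by (simp add: add_diff_eq)
qed

section \<open>Matroids and their contractions\<close>

lemma rk_eqI:
  assumes "finite (ground M)" "indep M \<subseteq> Pow (ground M)"
    and "\<And>I. I \<in> indep M \<Longrightarrow> I \<subseteq> X \<Longrightarrow> card I \<le> r"
    and "J \<in> indep M" "J \<subseteq> X" "card J = r"
  shows "rk M X = r"
proof -
  have "finite (indep M)" using assms(1,2) by (meson finite_Pow_iff finite_subset)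
  then have "finite (card ` {I \<in> indep M. I \<subseteq> X})" by simp
  moreover have "r \<in> card ` {I \<in> indep M. I \<subseteq> X}" using assms(4-6) by blast
  ultimately show ?thesis unfolding rk_def using assms(3) by (intro Max_eqI) blast+
qed

context
  fixes M :: "'a matroid"
  assumes M: "is_matroid M"
begin

lemma matroid_finite_ground: "finite (ground M)"
  and matroid_indep_subset: "I \<in> indep M \<Longrightarrow> I \<subseteq> ground M"
  and matroid_empty: "{} \<in> indep M"
  and matroid_hereditary: "I \<in> indep M \<Longrightarrow> J \<subseteq> I \<Longrightarrow> J \<in> indep M"
  and matroid_augment: "I \<in> indep M \<Longrightarrow> J \<in> indep M \<Longrightarrow> card I < card J \<Longrightarrow> \<exists>x\<in>J - I. insert x I \<in> indep M"
  using M unfolding is_matroid_def by blast+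

lemma matroid_finite_indep: "I \<in> indep M \<Longrightarrow> finite I"
  using matroid_finite_ground matroid_indep_subset finite_subset by blast

lemma matroid_finite_indeps: "finite (indep M)"
proof (rule finite_subset)
  show "indep M \<subseteq> Pow (ground M)" using matroid_indep_subset by blast
qed (use matroid_finite_ground in simp)

lemma finite_flats: "finite (flats M)"
proof (rule finite_subset)
  show "flats M \<subseteq> Pow (ground M)" unfolding flats_def by blast
qed (use matroid_finite_ground in simp)

lemma card_le_rk: "I \<in> indep M \<Longrightarrow> I \<subseteq> X \<Longrightarrow> card I \<le> rk M X"
  unfolding rk_def using matroid_finite_indeps by (intro Max_ge) auto

lemma rk_witness: "\<exists>I\<in>indep M. I \<subseteq> X \<and> card I = rk M X"
proof -
  have "rk M X \<in> card ` {I \<in> indep M. I \<subseteq> X}"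
    unfolding rk_def
  proof (rule Max_in)
    show "finite (card ` {I \<in> indep M. I \<subseteq> X})" using matroid_finite_indeps by simp
    show "card ` {I \<in> indep M. I \<subseteq> X} \<noteq> {}" using matroid_empty by blast
  qed
  then show ?thesis by auto
qed

lemma rk_eqI_matroid:
  "(\<And>I. I \<in> indep M \<Longrightarrow> I \<subseteq> X \<Longrightarrow> card I \<le> r) \<Longrightarrow> J \<in> indep M \<Longrightarrow> J \<subseteq> X \<Longrightarrow> card J = r \<Longrightarrow> rk M X = r"
  by (rule rk_eqI) (use matroid_finite_ground matroid_indep_subset in auto)

lemma extend_indep:
  assumes "I \<in> indep M" "J \<in> indep M" "card I \<le> card J"
  shows "\<exists>K\<in>indep M. I \<subseteq> K \<and> K \<subseteq> I \<union> J \<and> card K = card J"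
  using assms
proof (induction "card J - card I" arbitrary: I)
  case 0
  then show ?case by (intro bexI[of _ I]) auto
next
  case (Suc n)
  then have "card I < card J" by linarith
  then obtain x where x: "x \<in> J - I" "insert x I \<in> indep M"
    using matroid_augment[of I J] Suc.prems by blast
  have "card (insert x I) = Suc (card I)" using x matroid_finite_indep Suc.prems by simp
  then have "\<exists>K\<in>indep M. insert x I \<subseteq> K \<and> K \<subseteq> insert x I \<union> J \<and> card K = card J"
    using Suc.hyps(2) Suc.prems x by (intro Suc.hyps(1)) linarith+
  then show ?case using x by blast
qed

lemma basis_of_iff_card: "basis_of M X B \<longleftrightarrow> B \<in> indep M \<and> B \<subseteq> X \<and> card B = rk M X"
proof
  assume B: "basis_of M X B"
  then have B': "B \<in> indep M" "B \<subseteq> X" unfolding basis_of_def by auto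
  obtain J where J: "J \<in> indep M" "J \<subseteq> X" "card J = rk M X" using rk_witness by blast
  obtain K where K: "K \<in> indep M" "B \<subseteq> K" "K \<subseteq> B \<union> J" "card K = card J"
    using extend_indep[of B J] B' J card_le_rk by metis
  then have "K = B" using B B' J unfolding basis_of_def by blast
  with K J B' show "B \<in> indep M \<and> B \<subseteq> X \<and> card B = rk M X" by simp
next
  assume B: "B \<in> indep M \<and> B \<subseteq> X \<and> card B = rk M X"
  show "basis_of M X B" unfolding basis_of_def
  proof (intro conjI ballI impI)
    fix I assume I: "I \<in> indep M" "B \<subseteq> I" "I \<subseteq> X"
    have "card I \<le> card B" using card_le_rk[OF I(1,3)] B by simp
    then show "I = B" using card_seteq[of I B] I matroid_finite_indep by auto
  qed (use B in auto)
qed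

lemma basis_of_exists: "\<exists>B. basis_of M X B"
  unfolding basis_of_iff_card using rk_witness by blast


end

text \<open>Extend B by elements of I and A to size |I| + rk F. The result meets F in an independent
  set containing B, hence exactly in B, so its other elements lie in I, and by its size it is the
  union of I and B. Thus the choice of the basis in \<open>contraction\<close> does not
  matter.\<close>

lemma indep_union_basis_imp:
  assumes M: "is_matroid M" and "I \<inter> F = {}" and A: "basis_of M F A" and B: "basis_of M F B" and IA: "I \<union> A \<in> indep M"
  shows "I \<union> B \<in> indep M"
proof -
  have A': "A \<in> indep M" "A \<subseteq> F" "card A = rk M F" and B': "B \<in> indep M" "B \<subseteq> F" "card B = rk M F"
    using A B unfolding basis_of_iff_card[OF M] by simp_all
  have fin: "finite I" "finite A" "finite B"
    using matroid_finite_indep[OF M IA] matroid_finite_indep[OF M B'(1)] by simp_all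
  have "card (I \<union> A) = card I + rk M F"
    using fin A' assms(2) by (subst card_Un_disjoint) auto
  then obtain K where K: "K \<in> indep M" "B \<subseteq> K" "K \<subseteq> B \<union> (I \<union> A)" "card K = card I + rk M F"
    using extend_indep[OF M B'(1) IA] B' by auto
  have "K \<inter> F \<in> indep M" using matroid_hereditary[OF M K(1)] by simp
  moreover have "B \<subseteq> K \<inter> F" "K \<inter> F \<subseteq> F" using K B' by simp_all
  ultimately have "K \<inter> F = B" using B unfolding basis_of_def by metis
  then have "K \<subseteq> I \<union> B" using K A' by blast
  moreover have "card (I \<union> B) = card K" using fin B' assms(2) K by (subst card_Un_disjoint) auto
  ultimately have "K = I \<union> B" using fin by (simp add: card_subset_eq)
  then show ?thesis using K by simp
qed

context
  fixes M :: "'a matroid"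
  assumes M: "is_matroid M"
begin

lemma indep_contraction:
  assumes "basis_of M F B"
  shows "indep (contraction M F) = {I. I \<subseteq> ground M - F \<and> I \<union> B \<in> indep M}"
proof -
  have "(\<exists>A. basis_of M F A \<and> I \<union> A \<in> indep M) \<longleftrightarrow> I \<union> B \<in> indep M" if "I \<subseteq> ground M - F" for I
  proof -
    have "I \<inter> F = {}" using that by blast
    then show ?thesis
      using assms indep_union_basis_imp[OF M _ _ assms, of I] by metis
  qed
  then show ?thesis unfolding contraction_def by auto
qed

lemma ground_contraction [simp]: "ground (contraction M F) = ground M - F"
  by (simp add: contraction_def)

lemma is_matroid_contraction: "is_matroid (contraction M F)"
proof -
  obtain B where B: "basis_of M F B" using basis_of_exists[OF M] by blast
  then have B': "B \<in> indep M" "B \<subseteq> F" unfolding basis_of_def by simp_all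
  have "\<exists>x\<in>J - I. insert x I \<in> indep (contraction M F)"
    if I: "I \<in> indep (contraction M F)" and J: "J \<in> indep (contraction M F)" and less: "card I < card J" for I J
  proof -
    have I': "I \<subseteq> ground M - F" "I \<union> B \<in> indep M" and J': "J \<subseteq> ground M - F" "J \<union> B \<in> indep M"
      using I J unfolding indep_contraction[OF B] by simp_all
    have fin: "finite I" "finite J" "finite B"
      using matroid_finite_indep[OF M I'(2)] matroid_finite_indep[OF M J'(2)] by simp_all
    have "card (I \<union> B) = card I + card B" "card (J \<union> B) = card J + card B"
      using fin B' I' J' by (auto intro!: card_Un_disjoint)
    then obtain x where x: "x \<in> (J \<union> B) - (I \<union> B)" "insert x (I \<union> B) \<in> indep M"
      using matroid_augment[OF M I'(2) J'(2)] less by auto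
    then have "x \<in> J - I" "insert x I \<subseteq> ground M - F" "insert x I \<union> B \<in> indep M"
      using I' J' by auto
    then show ?thesis unfolding indep_contraction[OF B] by blast
  qed
  moreover have "J \<in> indep (contraction M F)" if I: "I \<in> indep (contraction M F)" and "J \<subseteq> I" for I J
  proof -
    have "I \<subseteq> ground M - F" "I \<union> B \<in> indep M" "J \<union> B \<subseteq> I \<union> B"
      using that unfolding indep_contraction[OF B] by auto
    then show ?thesis
      using matroid_hereditary[OF M, of "I \<union> B" "J \<union> B"] \<open>J \<subseteq> I\<close>
      unfolding indep_contraction[OF B] mem_Collect_eq by (meson subset_trans)
  qed
  moreover have "{} \<in> indep (contraction M F)" "indep (contraction M F) \<subseteq> Pow (ground (contraction M F))"
    using B' unfolding indep_contraction[OF B] by auto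
  moreover have "finite (ground (contraction M F))" using matroid_finite_ground[OF M] by simp
  ultimately show ?thesis
    unfolding is_matroid_def by blast
qed

text \<open>A basis of F extends to one of M, and its maximality in F forces the added elements to
  lie outside F; they form a basis of the contraction.\<close>

lemma rank_contraction: "rank (contraction M F) = rank M - rk M F"
proof -
  obtain B where B: "basis_of M F B" using basis_of_exists[OF M] by blast
  then have B': "B \<in> indep M" "B \<subseteq> F" "card B = rk M F" unfolding basis_of_iff_card[OF M] by simp_all
  obtain J where J: "J \<in> indep M" "card J = rank M" using rk_witness[OF M] by blast
  have "card B \<le> card J"
    using card_le_rk[OF M B'(1) matroid_indep_subset[OF M B'(1)]] J by simp
  then obtain K where K: "K \<in> indep M" "B \<subseteq> K" "K \<subseteq> B \<union> J" "card K = card J"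
    using extend_indep[OF M B'(1) J(1)] by blast
  have "K \<inter> F \<in> indep M" using matroid_hereditary[OF M K(1)] by simp
  moreover have "B \<subseteq> K \<inter> F" "K \<inter> F \<subseteq> F" using K B' by simp_all
  ultimately have "K \<inter> F = B" using B unfolding basis_of_def by metis
  then have KF: "K - B \<subseteq> ground M - F" using matroid_indep_subset[OF M K(1)] by blast
  show ?thesis
  proof (rule rk_eqI)
    have "K - B \<union> B = K" using K by blast
    then show "K - B \<in> indep (contraction M F)"
      using KF K by (simp add: indep_contraction[OF B])
    show "card (K - B) = rank M - rk M F"
      using K B' J matroid_finite_indep[OF M B'(1)] by (simp add: card_Diff_subset)
    fix I assume "I \<in> indep (contraction M F)"
    then have I: "I \<subseteq> ground M - F" "I \<union> B \<in> indep M" unfolding indep_contraction[OF B] by simp_all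
    have "card I + card B = card (I \<union> B)"
      using I B' matroid_finite_indep[OF M I(2)] by (subst card_Un_disjoint) auto
    also have "\<dots> \<le> rank M" using card_le_rk[OF M I(2) matroid_indep_subset[OF M I(2)]] .
    finally show "card I \<le> rank M - rk M F" using B' by simp
  next
    show "indep (contraction M F) \<subseteq> Pow (ground (contraction M F))"
      unfolding indep_contraction[OF B] by auto
    show "finite (ground (contraction M F))" using matroid_finite_ground[OF M] by simp
    show "K - B \<subseteq> ground (contraction M F)" using KF by simp
  qed
qed

lemma contraction_empty: "contraction M {} = M"
proof -
  have "basis_of M {} {}" unfolding basis_of_def using matroid_empty[OF M] by simp
  then have "indep (contraction M {}) = {I. I \<subseteq> ground M \<and> I \<in> indep M}"
    using indep_contraction by simp
  also have "\<dots> = indep M" using matroid_indep_subset[OF M] by blast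
  finally show ?thesis by (intro matroid.expand) simp
qed

end

section \<open>Kazhdan--Lusztig families\<close>

context
  fixes P :: "'a matroid \<Rightarrow> int poly"
  assumes P: "KL_family P"
begin

lemma KL_family_rank_0: "is_matroid M \<Longrightarrow> rank M = 0 \<Longrightarrow> P M = 1"
  and KL_family_degree: "is_matroid M \<Longrightarrow> rank M > 0 \<Longrightarrow> 2 * degree (P M) < rank M"
  and KL_family_rec: "is_matroid M \<Longrightarrow>
    rev_poly (rank M) (P M) = (\<Sum>F\<in>flats M. char_poly (localization M F) * P (contraction M F))"
  using P unfolding KL_family_def by blast+

lemma KL_family_coeff_eq_0: "is_matroid M \<Longrightarrow> 0 < rank M \<Longrightarrow> rank M \<le> 2 * k \<Longrightarrow> coeff (P M) k = 0"
  using KL_family_degree[of M] by (intro coeff_eq_0) linarith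

lemma KL_family_degree_le: "is_matroid M \<Longrightarrow> degree (P M) \<le> rank M"
  using KL_family_degree[of M] KL_family_rank_0[of M] by (cases "rank M = 0") auto

text \<open>Coefficientwise the left side is linear in \<open>P M\<close>, whereas
  \<open>rev_poly\<close> refers to the degree.\<close>

lemma KL_family_coeff_rec:
  assumes "is_matroid M"
  shows "(if k \<le> rank M then coeff (P M) (rank M - k) else 0)
       = coeff (\<Sum>F\<in>flats M. char_poly (localization M F) * P (contraction M F)) k"
  using KL_family_rec[OF assms] KL_family_degree_le[OF assms] by (metis coeff_rev_poly)

lemma KL_family_contraction_ground: "is_matroid M \<Longrightarrow> P (contraction M (ground M)) = 1"
proof -
  assume M: "is_matroid M"
  have "rank (contraction M (ground M)) = 0" unfolding rank_contraction[OF M] by (rule diff_self_eq_0)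
  then show ?thesis by (rule KL_family_rank_0[OF is_matroid_contraction[OF M]])
qed

end

section \<open>Uniqueness, and matroids of rank 1\<close>

lemma localization_ground:
  assumes "is_matroid M"
  shows "localization M (ground M) = M"
proof -
  have "{I \<in> indep M. I \<subseteq> ground M} = indep M" using matroid_indep_subset[OF assms] by blast
  then show ?thesis by (simp add: localization_def)
qed

text \<open>A matroid of loops has the ground set as its only flat. This serves for the localization
  at {} and, in rank 1, at the set of loops.\<close>

lemma char_poly_indep_empty:
  "indep M = {{}} \<Longrightarrow> finite (ground M) \<Longrightarrow> char_poly M = 1"
proof -
  assume M: "indep M = {{}}" "finite (ground M)"
  have rk: "rk M X = 0" for X unfolding rk_def M by simp
  have "flats M = {ground M}" unfolding flats_def using rk by auto
  moreover have "(LEAST F. F = ground M) = ground M" by (rule Least_equality) auto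
  ultimately show ?thesis unfolding char_poly_def by (simp add: rk mobius.simps)
qed

lemma char_poly_localization_empty:
  assumes "is_matroid M"
  shows "char_poly (localization M {}) = 1"
  using matroid_empty[OF assms] by (intro char_poly_indep_empty) (auto simp: localization_def)

text \<open>Flats other than {} have contractions on smaller ground sets, so by induction the
  difference of the two recursions retains only the term at {}, which is P M - Q M itself. Hence its
  coefficient at k is a multiple of the one at \<open>rank M - k\<close>, and for k below half the
  rank the latter vanishes by the degree bound. Uniqueness gives the definite description in
  \<open>KL_poly\<close> its value.\<close>

lemma KL_family_unique:
  assumes P: "KL_family P" and Q: "KL_family Q" and M: "is_matroid M"
  shows "P M = Q M"
  using M
proof (induction "card (ground M)" arbitrary: M rule: less_induct)
  case less
  note M = less.prems
  show ?case
  proof (cases "rank M = 0")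
    case True
    then show ?thesis using KL_family_rank_0[OF P M] KL_family_rank_0[OF Q M] by simp
  next
    case False
    let ?f = "\<lambda>P. \<Sum>F\<in>flats M. char_poly (localization M F) * P (contraction M F)"
    have IH: "P (contraction M F) = Q (contraction M F)" if "F \<in> flats M" "F \<noteq> {}" for F
    proof (rule less.hyps)
      have "F \<subseteq> ground M" using that by (simp add: flats_def)
      then show "card (ground (contraction M F)) < card (ground M)"
        using matroid_finite_ground[OF M] that(2) unfolding ground_contraction[OF M]
        by (intro psubset_card_mono) auto
    qed (rule is_matroid_contraction[OF M])
    \<comment> \<open>The empty set is a flat only if M has no loops; otherwise all contractions in
      the sum are smaller and the two sums are equal.\<close>
    define \<delta> where "\<delta> = (if {} \<in> flats M then 1 else 0 :: int)"
    have diff: "?f P - ?f Q = smult \<delta> (P M - Q M)"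
    proof -
      have "?f P - ?f Q = (\<Sum>F\<in>flats M. char_poly (localization M F) * (P (contraction M F) - Q (contraction M F)))"
        by (simp add: sum_subtractf right_diff_distrib)
      also have "\<dots> = (\<Sum>F\<in>flats M. if F = {} then P M - Q M else 0)"
        by (intro sum.cong refl) (auto simp: IH contraction_empty[OF M] char_poly_localization_empty[OF M])
      finally show ?thesis using finite_flats[OF M] by (simp add: \<delta>_def)
    qed
    have rev: "coeff (P M) (rank M - k) - coeff (Q M) (rank M - k) = \<delta> * (coeff (P M) k - coeff (Q M) k)"
      if "k \<le> rank M" for k
    proof -
      have "coeff (P M) (rank M - k) - coeff (Q M) (rank M - k) = coeff (?f P - ?f Q) k"
        using KL_family_coeff_rec[OF P M, of k] KL_family_coeff_rec[OF Q M, of k] that by simp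
      then show ?thesis unfolding diff by simp
    qed
    note zero = KL_family_coeff_eq_0[OF P M] KL_family_coeff_eq_0[OF Q M]
    have "coeff (P M) k = coeff (Q M) k" for k
    proof (cases "rank M \<le> 2 * k")
      case True
      then show ?thesis using zero[of k] False by simp
    next
      case k: False
      then have "coeff (P M) (rank M - k) = 0" "coeff (Q M) (rank M - k) = 0"
        using zero[of "rank M - k"] False by auto
      then show ?thesis using rev[of "rank M - k"] k by simp
    qed
    then show ?thesis by (rule poly_eqI)
  qed
qed

lemma KL_poly_eq:
  assumes "KL_family P" "is_matroid M"
  shows "KL_poly M = P M"
  unfolding KL_poly_def
proof (rule the_equality)
  show "\<exists>Q. KL_family Q \<and> P M = Q M" using assms by blast
qed (use KL_family_unique[OF _ assms(1) assms(2)] in blast)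

text \<open>The only flats are the set of loops and the ground set. The degree bound makes
  \<open>P M\<close> constant. Comparing coefficients of t in the recursion, the flat of loops
  contributes 0, again by the degree bound, and the ground set contributes the leading coefficient
  of t - 1.\<close>

lemma KL_family_rank_1:
  assumes P: "KL_family P" and M: "is_matroid M" and rank: "rank M = 1"
  shows "P M = 1"
proof -
  define E where "E = ground M"
  define L where "L = {x \<in> E. {x} \<notin> indep M}"
  have card_le: "card I \<le> 1" if "I \<in> indep M" for I
    using card_le_rk[OF M that, of "ground M"] rank matroid_indep_subset[OF M that] by simp
  have rk: "rk M X = (if X \<subseteq> L then 0 else 1)" if X: "X \<subseteq> E" for X
  proof (cases "X \<subseteq> L")
    case True
    have "I = {}" if I: "I \<in> indep M" "I \<subseteq> X" for I
    proof (rule equals0I)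
      fix x assume "x \<in> I"
      then have "{x} \<in> indep M" "x \<in> L" using matroid_hereditary[OF M I(1)] I True by auto
      then show False by (simp add: L_def)
    qed
    then have "card I \<le> 0" if "I \<in> indep M" "I \<subseteq> X" for I
      using that by (metis card.empty le_refl)
    then have "rk M X = 0" by (rule rk_eqI_matroid[OF M _ matroid_empty[OF M]]) simp_all
    then show ?thesis using True by simp
  next
    case False
    then obtain x where "x \<in> X" "{x} \<in> indep M" using X by (auto simp: L_def)
    then have "rk M X = 1" using card_le by (intro rk_eqI_matroid[OF M, where J = "{x}"]) auto
    then show ?thesis using False by simp
  qed
  have LE: "L \<subseteq> E" "L \<noteq> E" using rank rk[of E] by (auto simp: L_def E_def split: if_splits)
  have flats: "flats M = {L, E}"
  proof (intro subset_antisym subsetI)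
    fix F assume "F \<in> flats M"
    then have F: "F \<subseteq> E" "\<And>x. x \<in> E - F \<Longrightarrow> rk M F < rk M (insert x F)" by (auto simp: flats_def E_def)
    have "x \<notin> E - F" if "\<not> F \<subseteq> L \<or> x \<in> L" for x
    proof
      assume x: "x \<in> E - F"
      then have "insert x F \<subseteq> E" using F(1) by blast
      then show False using that F(2)[OF x] rk[OF F(1)] rk[of "insert x F"] by (simp split: if_splits)
    qed
    then show "F \<in> {L, E}" using F(1) LE by blast
  next
    fix F assume "F \<in> {L, E}"
    then show "F \<in> flats M" using LE rk by (auto simp: flats_def E_def[symmetric])
  qed
  have least: "(LEAST F. F = L \<or> F = E) = L" using LE by (intro Least_equality) auto
  have finE: "finite E" using matroid_finite_ground[OF M] by (simp add: E_def)
  have "{H \<in> {L, E}. L \<subseteq> H \<and> H \<subset> E} = {L}" using LE by auto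
  then have mob: "mobius {L, E} L E = - 1" "mobius {L, E} L L = 1"
    using LE finE by (subst mobius.simps; auto simp: mobius.simps[of _ L L])+
  have chi: "char_poly M = monom 1 1 - 1"
    using LE rk[of E] rk[of L] mob unfolding char_poly_def flats E_def[symmetric]
    by (simp add: least monom_0 one_pCons)
  have "indep (localization M L) = {{}}"
  proof -
    have "I = {}" if "I \<in> indep M" "I \<subseteq> L" for I
      using card_le_rk[OF M that] rk[of L] LE matroid_finite_indep[OF M that(1)] by simp
    then show ?thesis using matroid_empty[OF M] by (auto simp: localization_def)
  qed
  then have chiL: "char_poly (localization M L) = 1"
    using finE LE finite_subset by (intro char_poly_indep_empty) (auto simp: localization_def)
  have locE: "localization M E = M" unfolding E_def by (rule localization_ground[OF M])
  have "rank (contraction M L) = 1" using rank_contraction[OF M, of L] rank rk[of L] LE by simp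
  then have "coeff (P (contraction M L)) 1 = 0"
    by (intro KL_family_coeff_eq_0[OF P is_matroid_contraction[OF M]]) auto
  then have "coeff (P M) 0 = 1"
    using KL_family_coeff_rec[OF P M, of 1] LE KL_family_contraction_ground[OF P M] rank
    by (simp add: flats locE chiL chi E_def[symmetric] del: One_nat_def)
  moreover have "coeff (P M) k = 0" if "k > 0" for k
    using that rank by (intro KL_family_coeff_eq_0[OF P M]) auto
  ultimately show ?thesis by (intro poly_eqI) (auto simp: coeff_1)
qed

section \<open>Sparse paving matroids\<close>

lemma sum_subsets_by_card:
  fixes h :: "nat \<Rightarrow> 'a::comm_ring_1"
  assumes "finite C"
  shows "(\<Sum>F | F \<subseteq> C \<and> card F < n. h (card F)) = (\<Sum>i<n. of_nat (card C choose i) * h i)"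
proof -
  have fin: "finite {F. F \<subseteq> C \<and> card F < n}" using assms by simp
  have "(\<Sum>F | F \<subseteq> C \<and> card F < n. h (card F))
      = (\<Sum>i<n. \<Sum>F\<in>{F \<in> {F. F \<subseteq> C \<and> card F < n}. card F = i}. h (card F))"
    by (rule sum.group[symmetric]) (use fin in auto)
  also have "\<dots> = (\<Sum>i<n. of_nat (card C choose i) * h i)"
  proof (intro sum.cong refl)
    fix i assume "i \<in> {..<n}"
    then have "{F \<in> {F. F \<subseteq> C \<and> card F < n}. card F = i} = {F. F \<subseteq> C \<and> card F = i}" by auto
    then show "(\<Sum>F\<in>{F \<in> {F. F \<subseteq> C \<and> card F < n}. card F = i}. h (card F)) = of_nat (card C choose i) * h i"
      using n_subsets[OF assms, of i] by simp
  qed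
  finally show ?thesis .
qed

lemma sum_Pow_by_card:
  fixes h :: "nat \<Rightarrow> 'a::comm_ring_1"
  assumes "finite C"
  shows "(\<Sum>F\<in>Pow C. h (card F)) = (\<Sum>i\<le>card C. of_nat (card C choose i) * h i)"
proof -
  have "Pow C = {F. F \<subseteq> C \<and> card F < Suc (card C)}" using assms by (auto simp: less_Suc_eq_le card_mono)
  then show ?thesis using sum_subsets_by_card[OF assms, of h "Suc (card C)"] by (simp only: lessThan_Suc_atMost)
qed

lemma mobius_boolean:
  assumes "finite F" "\<And>H. H \<subset> F \<Longrightarrow> H \<in> L"
  shows "mobius L {} F = (- 1) ^ card F"
  using assms
proof (induction F rule: finite_psubset_induct)
  case (psubset F)
  show ?case
  proof (cases "F = {}")
    case False
    have eq: "{H \<in> L. {} \<subseteq> H \<and> H \<subset> F} = Pow F - {F}" using psubset.prems by auto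
    have "mobius L {} F = - (\<Sum>H\<in>Pow F - {F}. mobius L {} H)"
      using False psubset.hyps by (subst mobius.simps) (simp only: eq, auto)
    also have "(\<Sum>H\<in>Pow F - {F}. mobius L {} H) = (\<Sum>H\<in>Pow F - {F}. (- 1) ^ card H)"
      using psubset by (intro sum.cong refl) auto
    also have "\<dots> = (\<Sum>H\<in>Pow F. (- 1) ^ card H) - (- 1) ^ card F"
      using psubset.hyps by (simp add: sum_diff1)
    also have "(\<Sum>H\<in>Pow F. (- 1) ^ card H) = (0::int)"
      using choose_alternating_sum[of "card F", where 'a=int] False psubset.hyps
      by (simp add: sum_Pow_by_card mult.commute card_gt_0_iff)
    finally show ?thesis by simp
  qed (simp add: mobius.simps)
qed

lemma char_poly_boolean:
  assumes "finite E"
  shows "char_poly (Matroid E (Pow E)) = [:-1, 1:] ^ card E"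
proof -
  let ?M = "Matroid E (Pow E)"
  have rk: "rk ?M X = card X" if "X \<subseteq> E" for X
    by (rule rk_eqI[where J = X]) (use assms that in \<open>auto intro: card_mono finite_subset\<close>)
  have "rk ?M F < rk ?M (insert x F)" if "F \<subseteq> E" "x \<in> E - F" for F x
  proof -
    have "finite F" using that assms finite_subset by blast
    then show ?thesis using that by (simp add: rk)
  qed
  then have flats: "flats ?M = Pow E" unfolding flats_def by auto
  have least: "(LEAST F. F \<in> Pow E) = {}" by (rule Least_equality) auto
  have mu: "mobius (Pow E) {} F = (- 1) ^ card F" if "F \<in> Pow E" for F
    using that assms by (intro mobius_boolean) (auto intro: finite_subset)
  have "char_poly ?M = (\<Sum>F\<in>Pow E. monom ((- 1) ^ card F) (card E - card F))"
    unfolding char_poly_def flats least using assms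
    by (intro sum.cong refl) (auto simp: mu rk)
  also have "\<dots> = (\<Sum>i\<le>card E. of_nat (card E choose i) * monom ((- 1) ^ i) (card E - i))"
    by (rule sum_Pow_by_card[OF assms])
  also have "\<dots> = (\<Sum>i\<le>card E. of_nat (card E choose i) * (- 1) ^ i * [:0, 1:] ^ (card E - i))"
  proof (intro sum.cong refl)
    fix i
    have "monom ((- 1 :: int) ^ i) n = (- 1) ^ i * [:0, 1:] ^ n" for n
      by (cases "even i") (simp_all add: monom_altdef)
    then show "of_nat (card E choose i) * monom ((- 1 :: int) ^ i) (card E - i)
      = of_nat (card E choose i) * (- 1) ^ i * [:0, 1:] ^ (card E - i)" by (simp only: mult.assoc)
  qed
  also have "\<dots> = (- 1 + [:0, 1:]) ^ card E" by (simp only: binomial_ring)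
  also have "- 1 + [:0, 1:] = [:-1, 1 :: int:]" by (simp add: one_pCons)
  finally show ?thesis .
qed

section \<open>The matroid of a sparse family and its contractions\<close>

text \<open>This is a matroid of rank \<open>d\<close> only under the assumption \<open>sparse_family\<close> below.\<close>

definition spm :: "'a set \<Rightarrow> nat \<Rightarrow> 'a set set \<Rightarrow> 'a matroid" where
  "spm E d K = Matroid E ({I. I \<subseteq> E \<and> card I \<le> d} - K)"

lemma ground_spm [simp]: "ground (spm E d K) = E"
  and indep_spm: "indep (spm E d K) = {I. I \<subseteq> E \<and> card I \<le> d} - K"
  by (simp_all add: spm_def)

text \<open>For d-sets the last condition means that the symmetric difference has at least 4
  elements; in this form it survives contraction, which lowers the intersection and d equally. The
  strict bound on d encodes m >= 1.\<close>

definition sparse_family :: "'a set \<Rightarrow> nat \<Rightarrow> 'a set set \<Rightarrow> bool" where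
  "sparse_family E d K \<longleftrightarrow> finite E \<and> 1 \<le> d \<and> d < card E \<and> (\<forall>C\<in>K. C \<subseteq> E \<and> card C = d) \<and>
     (\<forall>C\<in>K. \<forall>C'\<in>K. C \<noteq> C' \<longrightarrow> card (C \<inter> C') + 2 \<le> d)"

lemma sparse_family_empty: "finite E \<Longrightarrow> 1 \<le> d \<Longrightarrow> d < card E \<Longrightarrow> sparse_family E d {}"
  by (simp add: sparse_family_def)

context
  fixes E :: "'a set" and d :: nat and K :: "'a set set"
  assumes S: "sparse_family E d K"
begin

lemma sparse_finite: "finite E" and sparse_pos: "1 \<le> d" and sparse_less: "d < card E"
  using S by (simp_all add: sparse_family_def)

lemma sparse_subset: "C \<in> K \<Longrightarrow> C \<subseteq> E" and sparse_card: "C \<in> K \<Longrightarrow> card C = d"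
  using S by (simp_all add: sparse_family_def)

lemma sparse_finite_subset: "X \<subseteq> E \<Longrightarrow> finite X"
  using sparse_finite finite_subset by blast

lemma sparse_finite_family: "finite K"
proof (rule finite_subset)
  show "K \<subseteq> Pow E" using sparse_subset by blast
qed (simp add: sparse_finite)

text \<open>Distinct members meet in at most d - 2 elements, too few to contain A. For |A| = d - 1
  this keeps the contributions of different circuit-hyperplanes apart.\<close>

lemma sparse_unique:
  assumes "C \<in> K" "C' \<in> K" "A \<subseteq> C" "A \<subseteq> C'" "d \<le> card A + 1"
  shows "C = C'"
proof (rule ccontr)
  assume "C \<noteq> C'"
  then have "card (C \<inter> C') + 2 \<le> d" using S assms by (simp add: sparse_family_def)
  moreover have "card A \<le> card (C \<inter> C')"
    using assms sparse_finite_subset[OF sparse_subset[OF assms(1)]] by (intro card_mono) auto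
  ultimately show False using assms(5) by simp
qed

lemma sparse_insert:
  assumes "x \<notin> J" "y \<notin> J" "x \<noteq> y" "d \<le> card J + 1"
  shows "insert x J \<notin> K \<or> insert y J \<notin> K"
  using sparse_unique[of "insert x J" "insert y J" J] assms by blast

text \<open>Fill J up to d - 1 elements; at least two elements of X remain, and by sparseness adding
  one of them avoids K.\<close>

lemma sparse_extend:
  assumes "J \<subseteq> X" "X \<subseteq> E" "card J < d" "d < card X"
  shows "\<exists>D. J \<subseteq> D \<and> D \<subseteq> X \<and> card D = d \<and> D \<notin> K"
proof -
  have finX: "finite X" using assms(2) by (rule sparse_finite_subset)
  have "card J \<le> d - 1" "d - 1 \<le> card X" using assms(3,4) by linarith+
  then obtain J' where J': "J \<subseteq> J'" "J' \<subseteq> X" "card J' = d - 1"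
    using exists_subset_between[of J "d - 1" X] assms(1) finX by blast
  have finJ: "finite J'" using J' finX finite_subset by blast
  have "card (X - J') = card X - card J'" using J' finJ by (simp add: card_Diff_subset)
  then have "2 \<le> card (X - J')" using J' assms by simp
  then obtain T where T: "T \<subseteq> X - J'" "card T = 2" by (meson obtain_subset_with_card_n)
  then obtain x y where xy: "x \<noteq> y" "x \<in> X - J'" "y \<in> X - J'" by (auto simp: card_2_iff)
  have "insert x J' \<notin> K \<or> insert y J' \<notin> K"
    using xy J' by (intro sparse_insert) auto
  moreover have "card (insert z J') = d" if "z \<in> X - J'" for z
    using that J' finJ assms by simp
  ultimately show ?thesis using xy J' by (metis Diff_iff insert_subset subset_insertI2)
qed

lemma is_matroid_spm: "is_matroid (spm E d K)"
proof -
  have "J \<in> indep (spm E d K)" if I: "I \<in> indep (spm E d K)" and JI: "J \<subseteq> I" for I J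
  proof -
    have I': "I \<subseteq> E" "card I \<le> d" "I \<notin> K" using I by (simp_all add: indep_spm)
    have "finite I" using I' sparse_finite_subset by blast
    then have "J = I \<or> card J < card I" using JI by (meson psubset_card_mono psubsetI)
    then show ?thesis using I' JI sparse_card[of J] by (auto simp: indep_spm)
  qed
  moreover have "\<exists>x\<in>J - I. insert x I \<in> indep (spm E d K)"
    if I: "I \<in> indep (spm E d K)" and J: "J \<in> indep (spm E d K)" and less: "card I < card J" for I J
  proof -
    have I': "I \<subseteq> E" "card I \<le> d" "I \<notin> K" and J': "J \<subseteq> E" "card J \<le> d" "J \<notin> K"
      using I J by (simp_all add: indep_spm)
    have fin: "finite I" "finite J" using I' J' sparse_finite_subset by blast+
    have "\<not> J \<subseteq> I" using card_mono[OF fin(1), of J] less by linarith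
    then obtain x where x: "x \<in> J - I" by blast
    have in_indep: "insert z I \<in> indep (spm E d K)" if "z \<in> J - I" "insert z I \<notin> K" for z
      using that I' J' fin less by (auto simp: indep_spm)
    show ?thesis
    proof (cases "insert x I \<in> K")
      case True
      then have cI: "card I + 1 = d" using sparse_card[OF True] x fin by simp
      have "J \<noteq> insert x I" using True J' by blast
      moreover have "card (insert x I) = card J" using cI less J' x fin by simp
      ultimately have "\<not> J \<subseteq> insert x I" using fin by (metis card_subset_eq finite_insert)
      then obtain y where y: "y \<in> J - I" "y \<noteq> x" by blast
      have "insert y I \<notin> K" using sparse_insert[of x I y] x y cI True by auto
      then show ?thesis using y in_indep by blast
    qed (use x in_indep in blast)
  qed
  moreover have "{} \<in> indep (spm E d K)" using sparse_pos sparse_card[of "{}"] by (auto simp: indep_spm)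
  moreover have "indep (spm E d K) \<subseteq> Pow (ground (spm E d K))" by (auto simp: indep_spm)
  ultimately show ?thesis
    unfolding is_matroid_def using sparse_finite by (simp only: ground_spm) blast
qed

lemma rk_spm:
  assumes "X \<subseteq> E"
  shows "rk (spm E d K) X = (if X \<in> K then d - 1 else min (card X) d)"
proof -
  have finX: "finite X" using assms by (rule sparse_finite_subset)
  have bound: "card I \<le> (if X \<in> K then d - 1 else min (card X) d)"
    if "I \<in> indep (spm E d K)" "I \<subseteq> X" for I
  proof -
    have "card I \<le> card X" "card I \<le> d" "I \<notin> K"
      using that card_mono[OF finX] by (simp_all add: indep_spm)
    moreover have "card I \<noteq> card X" if "X \<in> K"
      using card_subset_eq[OF finX \<open>I \<subseteq> X\<close>] \<open>I \<notin> K\<close> that by blast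
    ultimately show ?thesis using sparse_card[of X] by auto
  qed
  have "\<exists>J\<in>indep (spm E d K). J \<subseteq> X \<and> card J = (if X \<in> K then d - 1 else min (card X) d)"
  proof -
    consider "X \<in> K" | "X \<notin> K" "card X \<le> d" | "X \<notin> K" "d < card X" by linarith
    then show ?thesis
    proof cases
      case 1
      then obtain J where J: "J \<subseteq> X" "card J = d - 1"
        using obtain_subset_with_card_n[of "d - 1" X] sparse_card[of X] by auto
      then have "J \<notin> K" using sparse_card[of J] sparse_pos by auto
      then show ?thesis using J 1 assms by (intro bexI[of _ J]) (auto simp: indep_spm)
    next
      case 2
      then show ?thesis using assms by (intro bexI[of _ X]) (auto simp: indep_spm)
    next
      case 3
      then obtain D where "D \<subseteq> X" "card D = d" "D \<notin> K"
        using sparse_extend[of "{}" X] assms sparse_pos by auto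
      then show ?thesis using 3 assms by (intro bexI[of _ D]) (auto simp: indep_spm)
    qed
  qed
  then obtain J where "J \<in> indep (spm E d K)" "J \<subseteq> X" "card J = (if X \<in> K then d - 1 else min (card X) d)"
    by blast
  then show ?thesis using bound by (intro rk_eqI_matroid[OF is_matroid_spm]) simp_all
qed

lemma ground_notin_sparse: "E \<notin> K"
  using sparse_card[of E] sparse_less by auto

lemma rank_spm: "rank (spm E d K) = d"
  using rk_spm[of E] ground_notin_sparse sparse_less by simp

text \<open>A set of fewer than d elements is its own basis. The contraction stays in the class, so
  the induction on d can range over all sparse families.\<close>

lemma contraction_spm:
  assumes "F \<subseteq> E" "card F < d"
  shows "contraction (spm E d K) F = spm (E - F) (d - card F) ((\<lambda>C. C - F) ` {C \<in> K. F \<subseteq> C})"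
proof -
  have finF: "finite F" using assms(1) by (rule sparse_finite_subset)
  have FK: "F \<notin> K" using sparse_card[of F] assms by auto
  have "basis_of (spm E d K) F F"
    unfolding basis_of_iff_card[OF is_matroid_spm] using assms FK by (simp add: indep_spm rk_spm)
  then have ind: "indep (contraction (spm E d K) F) = {I. I \<subseteq> E - F \<and> I \<union> F \<in> indep (spm E d K)}"
    using indep_contraction[OF is_matroid_spm] by simp
  have "I \<union> F \<in> indep (spm E d K) \<longleftrightarrow> card I \<le> d - card F \<and> I \<notin> (\<lambda>C. C - F) ` {C \<in> K. F \<subseteq> C}"
    if I: "I \<subseteq> E - F" for I
  proof -
    have "finite I" "I \<inter> F = {}" using I sparse_finite_subset[of I] by auto
    then have "card (I \<union> F) = card I + card F" using finF by (simp add: card_Un_disjoint)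
    moreover have "I \<union> F \<in> K \<longleftrightarrow> I \<in> (\<lambda>C. C - F) ` {C \<in> K. F \<subseteq> C}"
    proof
      assume "I \<union> F \<in> K"
      then show "I \<in> (\<lambda>C. C - F) ` {C \<in> K. F \<subseteq> C}"
        using I by (intro image_eqI[of _ _ "I \<union> F"]) auto
    next
      assume "I \<in> (\<lambda>C. C - F) ` {C \<in> K. F \<subseteq> C}"
      then obtain C where "C \<in> K" "F \<subseteq> C" "I = C - F" by blast
      moreover from this have "I \<union> F = C" by blast
      ultimately show "I \<union> F \<in> K" by simp
    qed
    ultimately show ?thesis using I assms by (auto simp: indep_spm)
  qed
  then have "indep (contraction (spm E d K) F) = indep (spm (E - F) (d - card F) ((\<lambda>C. C - F) ` {C \<in> K. F \<subseteq> C}))"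
    unfolding ind by (auto simp: indep_spm)
  then show ?thesis by (intro matroid.expand) (simp add: ground_contraction[OF is_matroid_spm])
qed

lemma sparse_family_contract:
  assumes "F \<subseteq> E" "card F < d"
  shows "sparse_family (E - F) (d - card F) ((\<lambda>C. C - F) ` {C \<in> K. F \<subseteq> C})"
proof -
  have finF: "finite F" using assms(1) by (rule sparse_finite_subset)
  have "card ((C - F) \<inter> (C' - F)) + 2 \<le> d - card F"
    if "C \<in> K" "C' \<in> K" "F \<subseteq> C" "F \<subseteq> C'" "C - F \<noteq> C' - F" for C C'
  proof -
    have "C \<noteq> C'" using that by blast
    then have "card (C \<inter> C') + 2 \<le> d" using S that by (simp add: sparse_family_def)
    moreover have "(C - F) \<inter> (C' - F) = C \<inter> C' - F" by blast
    moreover have "card (C \<inter> C' - F) = card (C \<inter> C') - card F"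
      using that finF by (intro card_Diff_subset) auto
    moreover have "card F \<le> card (C \<inter> C')"
      using that sparse_finite_subset[OF sparse_subset[OF that(1)]] by (intro card_mono) auto
    ultimately show ?thesis by simp
  qed
  moreover have "C - F \<subseteq> E - F" "card (C - F) = d - card F" if "C \<in> K" "F \<subseteq> C" for C
    using that finF sparse_subset[of C] sparse_card[of C] by (auto simp: card_Diff_subset)
  moreover have "d - card F < card (E - F)"
    using assms finF sparse_less by (simp add: card_Diff_subset)
  ultimately show ?thesis
    unfolding sparse_family_def using assms sparse_finite by (auto simp: Suc_le_eq)
qed

end

section \<open>Flats, Moebius function and characteristic polynomial of \<open>spm\<close>\<close>

lemma smult_power_neg_1: "smult ((- 1) ^ i) p = (- 1) ^ i * (p :: 'a::comm_ring_1 poly)"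
  by (cases "even i") simp_all

text \<open>The full alternating sum over i <= d is 0; on the right stand its last two terms,
  negated.\<close>

lemma sum_alternating_binomial_less:
  assumes "2 \<le> d"
  shows "(\<Sum>i<d - 1. of_nat (d choose i) * (- 1) ^ i) = - (of_nat d * (- 1) ^ (d - 1) + (- 1 :: 'a::comm_ring_1) ^ d)"
proof -
  obtain n where n: "d = Suc (Suc n)" using assms by (metis Suc_le_D numeral_2_eq_2 Suc_le_mono)
  have "(\<Sum>i\<le>d. (- 1) ^ i * of_nat (d choose i)) = (0 :: 'a)" using assms by (intro choose_alternating_sum) simp
  then have "(\<Sum>i<d - 1. of_nat (d choose i) * (- 1) ^ i) + of_nat (d choose (d - 1)) * (- 1) ^ (d - 1) + (- 1) ^ d = (0 :: 'a)"
    unfolding n by (simp add: lessThan_Suc_atMost mult.commute)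
  moreover have "d choose (d - 1) = d" using binomial_symmetric[of 1 d] assms by simp
  ultimately show ?thesis by (simp only: eq_neg_iff_add_eq_0 add.assoc)
qed

text \<open>The characteristic polynomial of the uniform matroid of rank d on n elements. The
  Moebius value of the ground set is minus the sum of the others, which puts the -1 next to
  t^(d-i).\<close>

definition uniform_chi :: "nat \<Rightarrow> nat \<Rightarrow> int poly" where
  "uniform_chi n d = (\<Sum>i<d. of_nat (n choose i) * ((- 1) ^ i * ([:0, 1:] ^ (d - i) - 1)))"

context
  fixes E :: "'a set" and d :: nat and K :: "'a set set"
  assumes S: "sparse_family E d K"
begin

text \<open>The flats other than E and the members of K: a (d-1)-subset of some C in K spans C, so
  it is not closed.\<close>

definition low_flats :: "'a set set" where
  "low_flats = {F. F \<subseteq> E \<and> card F < d \<and> \<not> (card F + 1 = d \<and> (\<exists>C\<in>K. F \<subseteq> C))}"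

lemma flats_spm: "flats (spm E d K) = low_flats \<union> K \<union> {E}"
proof (intro subset_antisym subsetI)
  fix F assume "F \<in> flats (spm E d K)"
  then have F: "F \<subseteq> E" "\<And>x. x \<in> E - F \<Longrightarrow> rk (spm E d K) F < rk (spm E d K) (insert x F)"
    by (auto simp: flats_def)
  have finF: "finite F" using F(1) by (rule sparse_finite_subset[OF S])
  show "F \<in> low_flats \<union> K \<union> {E}"
  proof (rule ccontr)
    assume "F \<notin> low_flats \<union> K \<union> {E}"
    then have nF: "F \<notin> low_flats" "F \<notin> K" "F \<noteq> E" by auto
    have rkF: "rk (spm E d K) F = min (card F) d" using rk_spm[OF S F(1)] nF by simp
    show False
    proof (cases "card F < d")
      case True
      then obtain C where C: "C \<in> K" "F \<subseteq> C" "card F + 1 = d" using nF(1) F(1) by (auto simp: low_flats_def)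
      have "card (C - F) = 1" using C finF sparse_card[OF S C(1)] by (simp add: card_Diff_subset)
      then obtain x where x: "C - F = {x}" by (auto simp: card_1_singleton_iff)
      then have "insert x F = C" "x \<in> E - F" using C sparse_subset[OF S C(1)] by auto
      moreover have "rk (spm E d K) C = d - 1" using rk_spm[OF S sparse_subset[OF S C(1)]] C by simp
      ultimately show False using F(2)[of x] rkF C by simp
    next
      case False
      obtain x where x: "x \<in> E - F" using F(1) nF by blast
      then have "insert x F \<subseteq> E" using F(1) by blast
      then have "rk (spm E d K) (insert x F) \<le> d" using rk_spm[OF S] by simp
      then show False using F(2)[OF x] rkF False by simp
    qed
  qed
next
  fix F assume "F \<in> low_flats \<union> K \<union> {E}"
  then consider "F \<in> low_flats" | "F \<in> K" | "F = E" by blast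
  then show "F \<in> flats (spm E d K)"
  proof cases
    case 1
    then have F: "F \<subseteq> E" "card F < d" "\<And>C. C \<in> K \<Longrightarrow> F \<subseteq> C \<Longrightarrow> card F + 1 \<noteq> d" by (auto simp: low_flats_def)
    have finF: "finite F" using F(1) by (rule sparse_finite_subset[OF S])
    have "F \<notin> K" using F(2) sparse_card[OF S, of F] by auto
    moreover have "insert x F \<notin> K" if "x \<in> E - F" for x
      using F(3)[of "insert x F"] sparse_card[OF S, of "insert x F"] that finF by auto
    ultimately show ?thesis using F finF by (simp add: flats_def rk_spm[OF S])
  next
    case 2
    have finF: "finite F" using sparse_subset[OF S 2] by (rule sparse_finite_subset[OF S])
    have "insert x F \<notin> K" if "x \<in> E - F" for x
      using sparse_card[OF S, of "insert x F"] sparse_card[OF S 2] that finF by auto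
    then show ?thesis
      using 2 sparse_subset[OF S 2] sparse_card[OF S 2] sparse_pos[OF S] finF by (simp add: flats_def rk_spm[OF S])
  next
    case 3
    then show ?thesis by (simp add: flats_def)
  qed
qed

text \<open>Compared with the uniform matroid, whose flats are E and all sets of fewer than d
  elements, each C in K removes its (d-1)-subsets and adds itself. The removed families are disjoint
  by \<open>sparse_unique\<close>. The values of f at removed sets cancel, so a function on the
  flats may be extended to them at will.\<close>

lemma sum_flats_spm:
  fixes f :: "'a set \<Rightarrow> 'b::ab_group_add"
  shows "(\<Sum>F\<in>flats (spm E d K). f F)
       = (\<Sum>F | F \<subseteq> E \<and> card F < d. f F) - (\<Sum>C\<in>K. (\<Sum>H | H \<subseteq> C \<and> card H + 1 = d. f H) - f C) + f E"
proof -
  let ?A = "{F. F \<subseteq> E \<and> card F < d}" and ?B = "\<lambda>C. {H. H \<subseteq> C \<and> card H + 1 = d}"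
  have finA: "finite ?A" using sparse_finite[OF S] by simp
  have sub: "(\<Union>C\<in>K. ?B C) \<subseteq> ?A" using sparse_subset[OF S] by fastforce
  have low: "low_flats = ?A - (\<Union>C\<in>K. ?B C)" by (auto simp: low_flats_def)
  have finB: "finite (?B C)" if "C \<in> K" for C
    using sparse_finite_subset[OF S sparse_subset[OF S that]] by simp
  have "(\<Sum>F\<in>low_flats. f F) = (\<Sum>F\<in>?A. f F) - (\<Sum>H\<in>(\<Union>C\<in>K. ?B C). f H)"
    unfolding low using finA sub by (simp add: sum_diff)
  also have "(\<Sum>H\<in>(\<Union>C\<in>K. ?B C). f H) = (\<Sum>C\<in>K. \<Sum>H\<in>?B C. f H)"
  proof (rule sum.UNION_disjoint)
    show "\<forall>C\<in>K. \<forall>C'\<in>K. C \<noteq> C' \<longrightarrow> ?B C \<inter> ?B C' = {}"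
    proof (intro ballI impI equals0I)
      fix C C' H assume "C \<in> K" "C' \<in> K" "C \<noteq> C'" "H \<in> ?B C \<inter> ?B C'"
      then show False using sparse_unique[OF S, of C C' H] by auto
    qed
  qed (use sparse_finite_family[OF S] finB in auto)
  finally have 1: "(\<Sum>F\<in>low_flats. f F) = (\<Sum>F\<in>?A. f F) - (\<Sum>C\<in>K. \<Sum>H\<in>?B C. f H)" .
  have disj: "low_flats \<inter> K = {}" "(low_flats \<union> K) \<inter> {E} = {}"
    using sparse_card[OF S] sparse_less[OF S] by (auto simp: low_flats_def)
  have fin: "finite low_flats" "finite K" using finA low sparse_finite_family[OF S] by auto
  have "(\<Sum>F\<in>flats (spm E d K). f F) = (\<Sum>F\<in>low_flats. f F) + (\<Sum>F\<in>K. f F) + f E"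
    unfolding flats_spm using disj fin by (simp add: sum.union_disjoint)
  then show ?thesis unfolding 1 by (simp add: sum_subtractf)
qed

lemma mobius_low_flat:
  assumes "F \<in> low_flats"
  shows "mobius (flats (spm E d K)) {} F = (- 1) ^ card F"
proof (rule mobius_boolean)
  have F: "F \<subseteq> E" "card F < d" using assms by (auto simp: low_flats_def)
  show fin: "finite F" using F(1) by (rule sparse_finite_subset[OF S])
  fix H assume H: "H \<subset> F"
  then have "card H < card F" using fin by (rule psubset_card_mono[rotated])
  then have "H \<in> low_flats" using F H by (auto simp: low_flats_def)
  then show "H \<in> flats (spm E d K)" by (simp add: flats_spm)
qed

text \<open>The flats strictly below C are its subsets of at most d - 2 elements, so the defining
  sum is an alternating binomial sum without its last two terms.\<close>

lemma mobius_circuit_hyperplane: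
  assumes C: "C \<in> K" and d: "2 \<le> d"
  shows "mobius (flats (spm E d K)) {} C = of_nat d * (- 1) ^ (d - 1) + (- 1) ^ d"
proof -
  have finC: "finite C" and cC: "card C = d"
    using sparse_finite_subset[OF S sparse_subset[OF S C]] sparse_card[OF S C] by auto
  have eq: "{H \<in> flats (spm E d K). {} \<subseteq> H \<and> H \<subset> C} = {H. H \<subseteq> C \<and> card H < d - 1}"
  proof (intro subset_antisym subsetI)
    fix H assume "H \<in> {H \<in> flats (spm E d K). {} \<subseteq> H \<and> H \<subset> C}"
    then have H: "H \<in> flats (spm E d K)" "H \<subset> C" by auto
    have "card H < d" using psubset_card_mono[OF finC H(2)] cC by simp
    then have "H \<in> low_flats"
      using H(1) sparse_card[OF S, of H] sparse_less[OF S] by (auto simp: flats_spm)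
    then have "card H + 1 \<noteq> d" using H(2) C by (auto simp: low_flats_def)
    then show "H \<in> {H. H \<subseteq> C \<and> card H < d - 1}" using H(2) \<open>card H < d\<close> by auto
  next
    fix H assume H: "H \<in> {H. H \<subseteq> C \<and> card H < d - 1}"
    then have "H \<in> low_flats" using sparse_subset[OF S C] by (auto simp: low_flats_def)
    then show "H \<in> {H \<in> flats (spm E d K). {} \<subseteq> H \<and> H \<subset> C}" using H cC by (auto simp: flats_spm)
  qed
  have "mobius (flats (spm E d K)) {} C = - (\<Sum>H | H \<subseteq> C \<and> card H < d - 1. mobius (flats (spm E d K)) {} H)"
    using finC cC d by (subst mobius.simps) (simp only: eq, auto)
  also have "(\<Sum>H | H \<subseteq> C \<and> card H < d - 1. mobius (flats (spm E d K)) {} H) = (\<Sum>H | H \<subseteq> C \<and> card H < d - 1. (- 1) ^ card H)"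
    using sparse_subset[OF S C] by (intro sum.cong refl mobius_low_flat) (auto simp: low_flats_def)
  also have "\<dots> = - (of_nat d * (- 1) ^ (d - 1) + (- 1) ^ d)"
    by (simp only: sum_subsets_by_card[OF finC] cC sum_alternating_binomial_less[OF d])
  finally show ?thesis by simp
qed

text \<open>Each C loses d terms (-1)^(d-1) (t - 1) from its (d-1)-subsets and gains its own Moebius
  value times t - 1; the net loss is one such term. The hypothesis makes {} the least flat.\<close>

lemma char_poly_spm:
  assumes d: "2 \<le> d \<or> K = {}"
  shows "char_poly (spm E d K) = uniform_chi (card E) d - of_nat (card K) * ((- 1) ^ (d - 1) * [:-1, 1:])"
proof -
  let ?L = "flats (spm E d K)"
  let ?\<mu> = "mobius ?L {}"
  define c :: int where "c = of_nat d * (- 1) ^ (d - 1) + (- 1) ^ d"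
  \<comment> \<open>The Moebius value of E is spread over the other flats: each contributes its
    value times t^(d - rank) - 1, and E nothing. The Boolean formula is kept on the (d-1)-subsets of
    members of K, which are not flats, so that the sum over all small sets is
    \<open>uniform_chi\<close>.\<close>
  define g :: "'a set \<Rightarrow> int poly" where
    "g F = (if F = E then 0 else if F \<in> K then smult c [:-1, 1:]
      else (- 1) ^ card F * ([:0, 1:] ^ (d - card F) - 1))" for F
  have "{} \<in> low_flats" using d sparse_pos[OF S] by (auto simp: low_flats_def)
  then have emptyL: "{} \<in> ?L" by (simp add: flats_spm)
  then have least: "(LEAST F. F \<in> ?L) = {}" by (intro Least_equality) auto
  have EL: "E \<in> ?L" by (simp add: flats_spm)
  have finL: "finite ?L" by (rule finite_flats[OF is_matroid_spm[OF S]])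
  have monom_eq: "monom ((- 1) ^ i) n - monom ((- 1) ^ i) 0 = (- 1) ^ i * ([:0, 1 :: int:] ^ n - 1)" for i n
  proof -
    have "monom ((- 1) ^ i) n = (- 1) ^ i * [:0, 1 :: int:] ^ n" for n
      by (simp add: monom_altdef smult_power_neg_1)
    from this[of n] this[of 0] show ?thesis by (simp add: right_diff_distrib)
  qed
  have g: "(if F = E then 0 else monom (?\<mu> F) (d - rk (spm E d K) F) - monom (?\<mu> F) 0) = g F" if F: "F \<in> ?L" for F
  proof -
    consider "F \<in> low_flats" "F \<noteq> E" | "F \<in> K" "F \<noteq> E" | "F = E" using F by (auto simp: flats_spm)
    then show ?thesis
    proof cases
      case 1
      then have "F \<subseteq> E" "card F < d" "F \<notin> K" using sparse_card[OF S, of F] by (auto simp: low_flats_def)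
      then show ?thesis using 1 by (simp add: g_def mobius_low_flat rk_spm[OF S] monom_eq)
    next
      case 2
      then have "2 \<le> d" using d by auto
      have "monom c 1 - monom c 0 = smult c [:-1, 1:]" by (simp add: monom_altdef)
      moreover have "d - (d - 1) = 1" using \<open>2 \<le> d\<close> by simp
      ultimately show ?thesis
        using 2 mobius_circuit_hyperplane[OF 2(1) \<open>2 \<le> d\<close>] sparse_subset[OF S 2(1)]
        by (simp only: g_def rk_spm[OF S] if_True if_False c_def)
    qed (simp add: g_def)
  qed
  have "mobius ?L {} E = - (\<Sum>F\<in>?L - {E}. ?\<mu> F)"
  proof -
    have "{F \<in> ?L. {} \<subseteq> F \<and> F \<subset> E} = ?L - {E}" by (auto simp: flats_def)
    moreover have "E \<noteq> {}" using sparse_less[OF S] by auto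
    ultimately show ?thesis using sparse_finite[OF S] by (subst mobius.simps) (simp only:, auto)
  qed
  then have "monom (?\<mu> E) 0 = - (\<Sum>F\<in>?L - {E}. monom (?\<mu> F) 0)"
    by (simp only: minus_monom[symmetric]) (simp add: monom_sum)
  then have "char_poly (spm E d K) = (\<Sum>F\<in>?L - {E}. monom (?\<mu> F) (d - rk (spm E d K) F)) - (\<Sum>F\<in>?L - {E}. monom (?\<mu> F) 0)"
    unfolding char_poly_def least rank_spm[OF S] using finL EL rank_spm[OF S] by (simp add: sum.remove[of _ E])
  also have "\<dots> = (\<Sum>F\<in>?L - {E}. g F)"
    unfolding sum_subtractf[symmetric]
  proof (intro sum.cong refl)
    fix F assume "F \<in> ?L - {E}"
    then show "monom (?\<mu> F) (d - rk (spm E d K) F) - monom (?\<mu> F) 0 = g F" using g[of F] by simp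
  qed
  also have "\<dots> = (\<Sum>F\<in>?L. g F)"
    using finL EL by (simp add: sum.remove[of _ E] g_def)
  also have "\<dots> = (\<Sum>F | F \<subseteq> E \<and> card F < d. g F) - (\<Sum>C\<in>K. (\<Sum>H | H \<subseteq> C \<and> card H + 1 = d. g H) - g C)"
    by (simp add: sum_flats_spm g_def)
  also have "(\<Sum>F | F \<subseteq> E \<and> card F < d. g F) = uniform_chi (card E) d"
  proof -
    have "(\<Sum>F | F \<subseteq> E \<and> card F < d. g F) = (\<Sum>F | F \<subseteq> E \<and> card F < d. (- 1) ^ card F * ([:0, 1:] ^ (d - card F) - 1))"
      using sparse_card[OF S] sparse_less[OF S] by (intro sum.cong refl) (auto simp: g_def)
    then show ?thesis
      unfolding uniform_chi_def sum_subsets_by_card[OF sparse_finite[OF S], symmetric] .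
  qed
  also have "(\<Sum>C\<in>K. (\<Sum>H | H \<subseteq> C \<and> card H + 1 = d. g H) - g C) = (\<Sum>C\<in>K. (- 1) ^ (d - 1) * [:-1, 1:])"
  proof (intro sum.cong refl)
    fix C assume C: "C \<in> K"
    then have d: "2 \<le> d" using d by auto
    have finC: "finite C" and cC: "card C = d"
      using sparse_finite_subset[OF S sparse_subset[OF S C]] sparse_card[OF S C] by auto
    have "g H = (- 1) ^ (d - 1) * [:-1, 1:]" if "H \<subseteq> C" "card H + 1 = d" for H
    proof -
      have "H \<notin> K" "H \<noteq> E" using that sparse_card[OF S, of H] sparse_less[OF S] by auto
      moreover have "card H = d - 1" "d - card H = 1" using that by auto
      ultimately show ?thesis by (simp add: g_def one_pCons)
    qed
    then have "(\<Sum>H | H \<subseteq> C \<and> card H + 1 = d. g H) = of_nat (card {H. H \<subseteq> C \<and> card H + 1 = d}) * ((- 1) ^ (d - 1) * [:-1, 1:])"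
      by simp
    moreover have "card {H. H \<subseteq> C \<and> card H + 1 = d} = d"
    proof -
      have "{H. H \<subseteq> C \<and> card H + 1 = d} = {H. H \<subseteq> C \<and> card H = d - 1}" using d by auto
      then show ?thesis using n_subsets[OF finC, of "d - 1"] binomial_symmetric[of 1 d] d cC by simp
    qed
    moreover have "g C = (of_nat d * (- 1) ^ (d - 1) + (- 1) ^ d) * [:-1, 1:]"
    proof -
      have "C \<noteq> E" using cC sparse_less[OF S] by auto
      then have "g C = smult c [:-1, 1:]" using C by (simp only: g_def if_True if_False)
      also have "\<dots> = of_int c * [:-1, 1:]" by (simp add: of_int_poly)
      also have "of_int c = (of_nat d * (- 1) ^ (d - 1) + (- 1) ^ d :: int poly)" by (simp add: c_def)
      finally show ?thesis .
    qed
    moreover have "(- 1 :: int poly) ^ d = - ((- 1) ^ (d - 1))" using d by (cases d) auto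
    moreover have "a * (s * p) - (a * s + - s) * p = s * p" for a s p :: "int poly" by (simp add: algebra_simps)
    ultimately show "(\<Sum>H | H \<subseteq> C \<and> card H + 1 = d. g H) - g C = (- 1) ^ (d - 1) * [:-1, 1:]"
      by (simp only:)
  qed
  finally show ?thesis by simp
qed

lemma localization_low_flat:
  assumes "F \<subseteq> E" "card F < d"
  shows "localization (spm E d K) F = Matroid F (Pow F)"
proof -
  have "I \<in> indep (spm E d K)" if "I \<subseteq> F" for I
  proof -
    have "card I < d" using card_mono[OF sparse_finite_subset[OF S assms(1)] that] assms(2) by simp
    then show ?thesis using sparse_card[OF S, of I] that assms(1) by (auto simp: indep_spm)
  qed
  then show ?thesis by (auto simp: localization_def)
qed

text \<open>C is a circuit, so the independent sets inside it are its proper subsets.\<close>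

lemma localization_circuit_hyperplane:
  assumes "C \<in> K"
  shows "localization (spm E d K) C = spm C (d - 1) {}"
proof -
  have finC: "finite C" and cC: "card C = d" and CE: "C \<subseteq> E"
    using sparse_finite_subset[OF S sparse_subset[OF S assms]] sparse_card[OF S assms] sparse_subset[OF S assms] by auto
  have "I \<in> indep (spm E d K) \<longleftrightarrow> card I \<le> d - 1" if "I \<subseteq> C" for I
  proof
    assume "I \<in> indep (spm E d K)"
    then have "card I \<le> d" "I \<noteq> C" using assms by (auto simp: indep_spm)
    moreover from this have "card I \<noteq> d" using card_subset_eq[OF finC that] cC by auto
    ultimately show "card I \<le> d - 1" by simp
  next
    assume "card I \<le> d - 1"
    then have "card I < d" using sparse_pos[OF S] by simp
    then show "I \<in> indep (spm E d K)" using sparse_card[OF S, of I] that CE by (auto simp: indep_spm)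
  qed
  then show ?thesis by (auto simp: localization_def spm_def)
qed

end

section \<open>Comparison with the uniform matroid\<close>

text \<open>The right side is the chromatic polynomial of the d-cycle. The factor t completes the
  powers in \<open>uniform_chi\<close> to the expansion of (t - 1)^d without its last two
  terms.\<close>

lemma uniform_chi_circuit:
  assumes d: "2 \<le> d"
  shows "[:0, 1:] * uniform_chi d (d - 1) = [:-1, 1:] ^ d + (- 1) ^ d * [:-1, 1:]"
proof -
  define t :: "int poly" where "t = [:0, 1:]"
  have t1: "[:-1, 1:] = t - 1" by (simp add: t_def one_pCons)
  let ?c = "\<lambda>i. of_nat (d choose i) * (- 1) ^ i :: int poly"
  have "t * uniform_chi d (d - 1) = (\<Sum>i<d - 1. ?c i * t ^ (d - i) - ?c i * t)"
    unfolding uniform_chi_def sum_distrib_left t_def[symmetric]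
  proof (intro sum.cong refl)
    fix i assume "i \<in> {..<d - 1}"
    then have "d - i = Suc (d - 1 - i)" by auto
    then have "t ^ (d - i) = t * t ^ (d - 1 - i)" by (simp only: power_Suc)
    then show "t * (of_nat (d choose i) * ((- 1) ^ i * (t ^ (d - 1 - i) - 1))) = ?c i * t ^ (d - i) - ?c i * t"
      by (simp add: algebra_simps)
  qed
  also have "\<dots> = (\<Sum>i<d - 1. ?c i * t ^ (d - i)) - (\<Sum>i<d - 1. ?c i) * t"
    by (simp only: sum_subtractf sum_distrib_right)
  also have "(\<Sum>i<d - 1. ?c i) = - (of_nat d * (- 1) ^ (d - 1) + (- 1) ^ d)"
    by (rule sum_alternating_binomial_less[OF d])
  also have "(\<Sum>i<d - 1. ?c i * t ^ (d - i)) = (t - 1) ^ d - of_nat d * (- 1) ^ (d - 1) * t - (- 1) ^ d"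
  proof -
    obtain n where n: "d = Suc (Suc n)" using d by (metis Suc_le_D numeral_2_eq_2 Suc_le_mono)
    have "(t - 1) ^ d = (\<Sum>i\<le>d. ?c i * t ^ (d - i))"
      using binomial_ring[of "- 1" t d] by simp
    moreover have "d choose (d - 1) = d" using binomial_symmetric[of 1 d] d by simp
    ultimately show ?thesis
      unfolding n by (simp add: lessThan_Suc_atMost)
  qed
  finally show ?thesis unfolding t1 t_def[symmetric] by (simp add: algebra_simps)
qed

text \<open>As in \<open>char_poly_spm\<close>, each C replaces d hyperplanes with Boolean
  localization by one whose localization is a circuit. Contractions by hyperplanes have rank 1,
  hence polynomial 1.\<close>

lemma KL_sum_spm:
  assumes P: "KL_family P" and S: "sparse_family E d K" and d: "2 \<le> d"
  shows "(\<Sum>F\<in>flats (spm E d K). char_poly (localization (spm E d K) F) * P (contraction (spm E d K) F))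
     = (\<Sum>F | F \<subseteq> E \<and> card F < d. [:-1, 1:] ^ card F * (if card F + 1 = d then 1 else P (contraction (spm E d K) F)))
       - of_nat (card K) * (of_nat d * [:-1, 1:] ^ (d - 1) - uniform_chi d (d - 1)) + char_poly (spm E d K)"
proof -
  let ?M = "spm E d K"
  have M: "is_matroid ?M" by (rule is_matroid_spm[OF S])
  have rank_1: "P (contraction ?M F) = 1" if "rk ?M F = d - 1" for F
    using that d rank_contraction[OF M, of F] rank_spm[OF S]
    by (intro KL_family_rank_1[OF P is_matroid_contraction[OF M]]) simp
  \<comment> \<open>On (d-1)-sets, flats or not, the value does not involve K, so these summands
    cancel when K is compared with the empty family.\<close>
  define g where "g F = (if F = E then char_poly ?M else if F \<in> K then uniform_chi d (d - 1) else
      [:-1, 1:] ^ card F * (if card F + 1 = d then 1 else P (contraction ?M F)))" for F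
  have "char_poly (localization ?M F) * P (contraction ?M F) = g F" if F: "F \<in> flats ?M" for F
  proof -
    consider "F \<in> low_flats E d K" | "F \<in> K" | "F = E" using F by (auto simp: flats_spm[OF S])
    then show ?thesis
    proof cases
      case 1
      then have F': "F \<subseteq> E" "card F < d" by (auto simp: low_flats_def[OF S])
      then have FK: "F \<notin> K" "F \<noteq> E" using sparse_card[OF S, of F] sparse_less[OF S] by auto
      have "P (contraction ?M F) = 1" if "card F + 1 = d"
        using that F' FK by (intro rank_1) (simp add: rk_spm[OF S])
      then show ?thesis
        using F' FK sparse_finite_subset[OF S F'(1)]
        by (simp add: g_def localization_low_flat[OF S] char_poly_boolean)
    next
      case 2
      have "sparse_family F (d - 1) {}"
        using sparse_card[OF S 2] sparse_finite_subset[OF S sparse_subset[OF S 2]] d by (intro sparse_family_empty) auto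
      then have "char_poly (localization ?M F) = uniform_chi d (d - 1)"
        using char_poly_spm[of F "d - 1" "{}"] sparse_card[OF S 2] by (simp add: localization_circuit_hyperplane[OF S 2])
      moreover have "P (contraction ?M F) = 1"
        using 2 sparse_subset[OF S 2] by (intro rank_1) (simp add: rk_spm[OF S])
      moreover have "F \<noteq> E" using 2 ground_notin_sparse[OF S] by auto
      ultimately show ?thesis using 2 by (simp add: g_def)
    next
      case 3
      then show ?thesis
        using localization_ground[OF M] KL_family_contraction_ground[OF P M] by (simp add: g_def)
    qed
  qed
  then have "(\<Sum>F\<in>flats ?M. char_poly (localization ?M F) * P (contraction ?M F)) = (\<Sum>F\<in>flats ?M. g F)"
    by (intro sum.cong refl)
  also have "\<dots> = (\<Sum>F | F \<subseteq> E \<and> card F < d. g F) - (\<Sum>C\<in>K. (\<Sum>H | H \<subseteq> C \<and> card H + 1 = d. g H) - g C) + char_poly ?M"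
    unfolding sum_flats_spm[OF S] by (simp add: g_def)
  also have "(\<Sum>F | F \<subseteq> E \<and> card F < d. g F)
    = (\<Sum>F | F \<subseteq> E \<and> card F < d. [:-1, 1:] ^ card F * (if card F + 1 = d then 1 else P (contraction ?M F)))"
    using sparse_card[OF S] sparse_less[OF S] by (intro sum.cong refl) (auto simp: g_def)
  also have "(\<Sum>C\<in>K. (\<Sum>H | H \<subseteq> C \<and> card H + 1 = d. g H) - g C)
    = (\<Sum>C\<in>K. of_nat d * [:-1, 1:] ^ (d - 1) - uniform_chi d (d - 1))"
  proof (intro sum.cong refl)
    fix C assume C: "C \<in> K"
    have "g H = [:-1, 1:] ^ (d - 1)" if "card H + 1 = d" for H
    proof -
      have "H \<notin> K" "H \<noteq> E" using that sparse_card[OF S, of H] sparse_less[OF S] by auto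
      moreover have "card H = d - 1" using that by simp
      ultimately show ?thesis using that by (simp add: g_def)
    qed
    then have "(\<Sum>H | H \<subseteq> C \<and> card H + 1 = d. g H) = of_nat (card {H. H \<subseteq> C \<and> card H + 1 = d}) * [:-1, 1:] ^ (d - 1)"
      by simp
    moreover have "card {H. H \<subseteq> C \<and> card H + 1 = d} = d"
    proof -
      have "{H. H \<subseteq> C \<and> card H + 1 = d} = {H. H \<subseteq> C \<and> card H = d - 1}" using d by auto
      then show ?thesis
        using n_subsets[OF sparse_finite_subset[OF S sparse_subset[OF S C]], of "d - 1"]
          binomial_symmetric[of 1 d] d sparse_card[OF S C] by simp
    qed
    moreover have "g C = uniform_chi d (d - 1)" using C ground_notin_sparse[OF S] by (auto simp: g_def)
    ultimately show "(\<Sum>H | H \<subseteq> C \<and> card H + 1 = d. g H) - g C = of_nat d * [:-1, 1:] ^ (d - 1) - uniform_chi d (d - 1)"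
      by simp
  qed
  finally show ?thesis by simp
qed

text \<open>Each set F of fewer than d - 1 elements leaves the same kind of difference for the
  contraction by F; F = {} returns the original difference.\<close>

lemma KL_sum_diff:
  assumes P: "KL_family P" and S: "sparse_family E d K" and d: "2 \<le> d"
  defines "Q \<equiv> \<lambda>F L. P (spm (E - F) (d - card F) ((\<lambda>C. C - F) ` {C \<in> L. F \<subseteq> C}))"
  shows "(\<Sum>F\<in>flats (spm E d {}). char_poly (localization (spm E d {}) F) * P (contraction (spm E d {}) F))
     - (\<Sum>F\<in>flats (spm E d K). char_poly (localization (spm E d K) F) * P (contraction (spm E d K) F))
     = (\<Sum>F | F \<subseteq> E \<and> card F < d. [:-1, 1:] ^ card F * (if card F + 1 = d then 0 else Q F {} - Q F K))
       + of_nat (card K) * (of_nat d * [:-1, 1:] ^ (d - 1) - uniform_chi d (d - 1) + (- 1) ^ (d - 1) * [:-1, 1:])"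
proof -
  have S0: "sparse_family E d {}" using S by (simp add: sparse_family_def)
  let ?s = "\<lambda>K. \<Sum>F | F \<subseteq> E \<and> card F < d. [:-1, 1:] ^ card F * (if card F + 1 = d then 1 else P (contraction (spm E d K) F))"
  have "?s {} - ?s K = (\<Sum>F | F \<subseteq> E \<and> card F < d. [:-1, 1:] ^ card F * (if card F + 1 = d then 0 else Q F {} - Q F K))"
    unfolding sum_subtractf[symmetric] right_diff_distrib[symmetric]
    by (intro sum.cong refl) (simp add: Q_def contraction_spm[OF S] contraction_spm[OF S0])
  moreover have "char_poly (spm E d {}) - char_poly (spm E d K) = of_nat (card K) * ((- 1) ^ (d - 1) * [:-1, 1:])"
    using char_poly_spm[OF S] char_poly_spm[OF S0] d by simp
  moreover have "(a - of_nat (card ({} :: 'a set set)) * y + x) - (b - k * y + z) = (a - b) + (k * y + (x - z))" for a b x y z k :: "int poly"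
    by simp
  ultimately show ?thesis
    unfolding KL_sum_spm[OF P S d] KL_sum_spm[OF P S0 d] by (simp only: distrib_left)
qed

section \<open>Passage to real polynomials, as \<open>relax_coeff\<close> is a real quotient\<close>

lemma map_poly_of_int_add: "map_poly real_of_int (p + q) = map_poly real_of_int p + map_poly real_of_int q"
  and map_poly_of_int_diff: "map_poly real_of_int (p - q) = map_poly real_of_int p - map_poly real_of_int q"
  and map_poly_of_int_mult: "map_poly real_of_int (p * q) = map_poly real_of_int p * map_poly real_of_int q"
  by (rule poly_eqI; simp add: coeff_map_poly coeff_mult)+

lemma map_poly_of_int_sum: "map_poly real_of_int (sum f A) = (\<Sum>x\<in>A. map_poly real_of_int (f x))"
  by (induction A rule: infinite_finite_induct) (simp_all add: map_poly_of_int_add)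

lemma map_poly_of_int_power: "map_poly real_of_int (p ^ n) = map_poly real_of_int p ^ n"
  by (induction n) (simp_all add: map_poly_of_int_mult)

lemma map_poly_of_int_of_nat: "map_poly real_of_int (of_nat n) = of_nat n"
  by (simp add: of_nat_poly map_poly_pCons)

lemma map_poly_of_int_linear: "map_poly real_of_int [:a, b:] = [:of_int a, of_int b:]"
  by (simp add: map_poly_pCons)

lemma map_poly_of_int_uminus_1: "map_poly real_of_int (- 1) = - 1"
  by (rule poly_eqI) (simp add: coeff_map_poly)

lemmas map_poly_of_int_hom = map_poly_of_int_add map_poly_of_int_diff map_poly_of_int_mult map_poly_of_int_sum
  map_poly_of_int_power map_poly_of_int_of_nat map_poly_of_int_linear map_poly_of_int_uminus_1

text \<open>By induction, the recursions for the difference D and for n q_d, where n =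
  \<open>card K\<close>, agree up to the remainder D - n q_d. The remainder is therefore its own
  reversal, and as its coefficients vanish from d/2 on, it is 0.\<close>

lemma KL_uniform_minus_sparse_paving:
  assumes P: "KL_family P" and "sparse_family E d K" and "2 \<le> d"
  shows "map_poly real_of_int (P (spm E d {}) - P (spm E d K)) = of_nat (card K) * relax_poly d"
  using assms(2,3)
proof (induction d arbitrary: E K rule: less_induct)
  case (less d)
  note S = less.prems(1) and d = less.prems(2)
  have S0: "sparse_family E d {}" using S by (simp add: sparse_family_def)
  let ?T = "[:-1, 1:] :: real poly"
  let ?KF = "\<lambda>F. {C \<in> K. F \<subseteq> C}"
  define Q where "Q = (\<lambda>F L. P (spm (E - F) (d - card F) ((\<lambda>C. C - F) ` {C \<in> L. F \<subseteq> C})))"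
  define D where "D = map_poly real_of_int (P (spm E d {}) - P (spm E d K))"
  define \<chi> where "\<chi> = map_poly real_of_int (uniform_chi d (d - 1))"
  define Y where "Y = of_nat d * ?T ^ (d - 1) - \<chi> + (- 1) ^ (d - 1) * ?T"
  have IH: "map_poly real_of_int (Q F {} - Q F K) = of_nat (card (?KF F)) * relax_poly (d - card F)"
    if F: "F \<subseteq> E" "card F + 1 < d" "F \<noteq> {}" for F
  proof -
    have "finite F" using F(1) by (rule sparse_finite_subset[OF S])
    then have "d - card F < d" "2 \<le> d - card F" using F d by (auto simp: card_gt_0_iff)
    then have "map_poly real_of_int (Q F {} - Q F K) = of_nat (card ((\<lambda>C. C - F) ` ?KF F)) * relax_poly (d - card F)"
      using less.IH[of "d - card F" "E - F" "(\<lambda>C. C - F) ` ?KF F"] sparse_family_contract[OF S F(1)] F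
      by (simp add: Q_def)
    moreover have "inj_on (\<lambda>C. C - F) (?KF F)" by (rule inj_onI) blast
    ultimately show ?thesis by (simp add: card_image)
  qed
  have rev: "rev_bound d D = map_poly real_of_int
     ((\<Sum>F\<in>flats (spm E d {}). char_poly (localization (spm E d {}) F) * P (contraction (spm E d {}) F))
     - (\<Sum>F\<in>flats (spm E d K). char_poly (localization (spm E d K) F) * P (contraction (spm E d K) F)))"
  proof (rule poly_eqI)
    fix k
    have "coeff (rev_bound d D) k
      = of_int ((if k \<le> d then coeff (P (spm E d {})) (d - k) else 0) - (if k \<le> d then coeff (P (spm E d K)) (d - k) else 0))"
      by (simp add: coeff_rev_bound D_def coeff_map_poly)
    then show "coeff (rev_bound d D) k = coeff (map_poly real_of_int
     ((\<Sum>F\<in>flats (spm E d {}). char_poly (localization (spm E d {}) F) * P (contraction (spm E d {}) F))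
     - (\<Sum>F\<in>flats (spm E d K). char_poly (localization (spm E d K) F) * P (contraction (spm E d K) F)))) k"
      using KL_family_coeff_rec[OF P is_matroid_spm[OF S], of k] KL_family_coeff_rec[OF P is_matroid_spm[OF S0], of k]
      by (simp only: rank_spm[OF S] rank_spm[OF S0] coeff_map_poly coeff_diff of_int_0)
  qed
  let ?A = "{F. F \<subseteq> E \<and> card F < d}"
  have finA: "finite ?A" and emptyA: "{} \<in> ?A" using sparse_finite[OF S] d by auto
  have "rev_bound d D = (\<Sum>F\<in>?A. ?T ^ card F * map_poly real_of_int (if card F + 1 = d then 0 else Q F {} - Q F K))
     + of_nat (card K) * Y"
    unfolding rev KL_sum_diff[OF P S d]
    by (simp only: map_poly_of_int_hom Y_def \<chi>_def Q_def of_int_minus of_int_1)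
  \<comment> \<open>The set {} gives D itself, to which the induction hypothesis does not apply; D
    is written as its expected value plus a remainder. Sets of size d - 1 fit because q_1 =
    0.\<close>
  also have "(\<Sum>F\<in>?A. ?T ^ card F * map_poly real_of_int (if card F + 1 = d then 0 else Q F {} - Q F K))
    = (\<Sum>F\<in>?A. ?T ^ card F * (of_nat (card (?KF F)) * relax_poly (d - card F)) + (if F = {} then D - of_nat (card K) * relax_poly d else 0))"
  proof (intro sum.cong refl)
    fix F assume F: "F \<in> ?A"
    then have finF: "finite F" using sparse_finite_subset[OF S] by blast
    consider "F = {}" | "F \<noteq> {}" "card F + 1 = d" | "F \<noteq> {}" "card F + 1 < d" using F by fastforce
    then show "?T ^ card F * map_poly real_of_int (if card F + 1 = d then 0 else Q F {} - Q F K)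
      = ?T ^ card F * (of_nat (card (?KF F)) * relax_poly (d - card F)) + (if F = {} then D - of_nat (card K) * relax_poly d else 0)"
    proof cases
      case 1
      then show ?thesis using d by (simp add: Q_def D_def)
    next
      case 2
      then have "d - card F = 1" by simp
      then show ?thesis using 2 by (simp add: relax_poly_eq_0)
    next
      case 3
      then show ?thesis using IH[of F] F by simp
    qed
  qed
  also have "\<dots> = (\<Sum>F\<in>?A. ?T ^ card F * (of_nat (card (?KF F)) * relax_poly (d - card F))) + (D - of_nat (card K) * relax_poly d)"
    using finA emptyA by (simp add: sum.distrib)
  \<comment> \<open>The number of members of K containing F becomes an inner sum over these members;
    once the sums are exchanged, each C gives a binomial sum that depends on d alone.\<close>
  also have "(\<Sum>F\<in>?A. ?T ^ card F * (of_nat (card (?KF F)) * relax_poly (d - card F)))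
    = (\<Sum>F\<in>?A. \<Sum>C\<in>?KF F. ?T ^ card F * relax_poly (d - card F))"
    by (simp add: mult.left_commute)
  also have "\<dots> = (\<Sum>C\<in>K. \<Sum>F\<in>{F \<in> ?A. F \<subseteq> C}. ?T ^ card F * relax_poly (d - card F))"
    using finA sparse_finite_family[OF S] by (rule sum.swap_restrict)
  also have "\<dots> = (\<Sum>C\<in>K. \<Sum>i<d. of_nat (d choose i) * (?T ^ i * relax_poly (d - i)))"
  proof (intro sum.cong refl)
    fix C assume C: "C \<in> K"
    then have "{F \<in> ?A. F \<subseteq> C} = {F. F \<subseteq> C \<and> card F < d}" using sparse_subset[OF S] by blast
    then show "(\<Sum>F\<in>{F \<in> ?A. F \<subseteq> C}. ?T ^ card F * relax_poly (d - card F)) = (\<Sum>i<d. of_nat (d choose i) * (?T ^ i * relax_poly (d - i)))"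
      using sum_subsets_by_card[OF sparse_finite_subset[OF S sparse_subset[OF S C]], of "\<lambda>i. ?T ^ i * relax_poly (d - i)" d]
        sparse_card[OF S C] by simp
  qed
  \<comment> \<open>The summand i = d may be added because q_0 = 0.\<close>
  also have "\<dots> = of_nat (card K) * (\<Sum>i\<le>d. of_nat (d choose i) * ?T ^ i * relax_poly (d - i))"
    by (simp add: relax_poly_eq_0 mult.assoc flip: lessThan_Suc_atMost)
  finally have "rev_bound d D = of_nat (card K) * ((\<Sum>i\<le>d. of_nat (d choose i) * ?T ^ i * relax_poly (d - i)) + Y) + (D - of_nat (card K) * relax_poly d)"
    by (simp only: distrib_left add_ac)
  also have "(\<Sum>i\<le>d. of_nat (d choose i) * ?T ^ i * relax_poly (d - i)) + Y = rev_bound d (relax_poly d)"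
  proof -
    have "[:0, 1:] * \<chi> = ?T ^ d + (- 1) ^ d * ?T"
      using arg_cong[OF uniform_chi_circuit[OF d], of "map_poly real_of_int"]
      by (simp only: map_poly_of_int_hom \<chi>_def) simp
    from relax_poly_recursion[OF d this] show ?thesis by (simp add: Y_def)
  qed
  finally have "rev_bound d (D - of_nat (card K) * relax_poly d) = D - of_nat (card K) * relax_poly d"
    by (simp add: rev_bound_diff of_nat_poly rev_bound_smult)
  moreover have "coeff (D - of_nat (card K) * relax_poly d) k = 0" if k: "d \<le> 2 * k" for k
  proof -
    have "coeff (P (spm E d L)) k = 0" if "sparse_family E d L" for L
      using k d rank_spm[OF that] by (intro KL_family_coeff_eq_0[OF P is_matroid_spm[OF that]]) auto
    from this[OF S] this[OF S0] show ?thesis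
      using k by (simp add: D_def coeff_map_poly of_nat_poly coeff_relax_poly relax_coeff_def)
  qed
  ultimately have "D - of_nat (card K) * relax_poly d = 0" by (rule rev_bound_fixed_imp_zero)
  then show ?case by (simp add: D_def)
qed

section \<open>From \<open>sparse_paving\<close> to sparse families, and the theorem\<close>

lemma uniform_matroid_eq_spm: "uniform_matroid m d = spm {1..m + d} d {}"
  by (simp add: uniform_matroid_def spm_def)

lemma sparse_paving_imp_sparse_family:
  assumes M: "sparse_paving m d CH M" and "1 \<le> m" "1 \<le> d"
  shows "sparse_family {1..m + d} d CH"
proof -
  have CH: "C \<subseteq> {1..m + d}" "card C = d" if "C \<in> CH" for C
    using that M unfolding sparse_paving_def by auto
  have "card (C \<inter> C') + 2 \<le> d" if C: "C \<in> CH" "C' \<in> CH" "C \<noteq> C'" for C C'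
  proof -
    have fin: "finite C" "finite C'" using CH C finite_subset by blast+
    have "4 \<le> card ((C - C') \<union> (C' - C))" using M C unfolding sparse_paving_def by blast
    also have "\<dots> = card (C - C') + card (C' - C)" using fin by (intro card_Un_disjoint) auto
    also have "card (C - C') = d - card (C \<inter> C')" using CH[OF C(1)] fin by (simp add: card_Diff_subset_Int)
    also have "card (C' - C) = d - card (C \<inter> C')" using CH[OF C(2)] fin by (simp add: card_Diff_subset_Int Int_commute)
    finally show ?thesis by simp
  qed
  then show ?thesis using assms CH by (simp add: sparse_family_def)
qed

text \<open>\<open>sparse_paving\<close> prescribes sets of size d only. For m >= 1 a smaller set
  extends to a d-set outside CH, which is a basis, so it is independent. For m = 0 the ground set is
  the only d-set, and rank d makes it a basis.\<close>

lemma sparse_paving_eq_spm: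
  assumes SP: "sparse_paving m d CH M"
  shows "M = spm {1..m + d} d CH" and "m = 0 \<Longrightarrow> CH = {}"
proof -
  let ?E = "{1..m + d}"
  have M: "is_matroid M" and ground: "ground M = ?E" and rank: "rk M ?E = d"
    and CH: "CH = {C. C \<subseteq> ?E \<and> card C = d} - bases M"
    using SP unfolding sparse_paving_def by auto
  have basis: "B \<in> bases M \<longleftrightarrow> B \<in> indep M \<and> card B = d" for B
    unfolding bases_def ground using basis_of_iff_card[OF M, of ?E B] rank matroid_indep_subset[OF M, of B] ground by auto
  obtain J where J: "J \<in> indep M" "J \<subseteq> ?E" "card J = d" using rk_witness[OF M, of ?E] rank by auto
  have J0: "J = ?E" if "m = 0" using card_subset_eq[of ?E J] J that by simp
  show "CH = {}" if "m = 0"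
  proof -
    have "C = J" if "C \<subseteq> ?E" "card C = d" for C
      using card_subset_eq[of ?E C] that \<open>m = 0\<close> J0[OF \<open>m = 0\<close>] by simp
    then have "C \<in> bases M" if "C \<subseteq> ?E" "card C = d" for C using that J basis[of J] by metis
    then show ?thesis unfolding CH by blast
  qed
  have "I \<in> indep M \<longleftrightarrow> I \<subseteq> ?E \<and> card I \<le> d \<and> I \<notin> CH" for I
  proof
    assume I: "I \<in> indep M"
    have "I \<subseteq> ?E" using matroid_indep_subset[OF M I] ground by simp
    moreover from this have "card I \<le> d" using card_le_rk[OF M I, of ?E] rank by simp
    moreover have "I \<notin> CH" using I basis[of I] by (simp add: CH)
    ultimately show "I \<subseteq> ?E \<and> card I \<le> d \<and> I \<notin> CH" by blast
  next
    assume I: "I \<subseteq> ?E \<and> card I \<le> d \<and> I \<notin> CH"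
    consider "card I = d" | "m = 0" | "card I < d" "1 \<le> m" using I by linarith
    then show "I \<in> indep M"
    proof cases
      case 1
      then show ?thesis using I basis[of I] by (simp add: CH)
    next
      case 2
      then show ?thesis using matroid_hereditary[OF M J(1)] J0 I by simp
    next
      case 3
      then have "sparse_family ?E d CH" by (intro sparse_paving_imp_sparse_family[OF SP]) auto
      then obtain B where B: "I \<subseteq> B" "B \<subseteq> ?E" "card B = d" "B \<notin> CH"
        using sparse_extend[of ?E d CH I ?E] I 3 by auto
      then have "B \<in> indep M" using basis[of B] by (simp add: CH)
      then show ?thesis using matroid_hereditary[OF M _ B(1)] by blast
    qed
  qed
  then have "indep M = indep (spm ?E d CH)" by (auto simp: indep_spm)
  then show "M = spm ?E d CH" using ground by (intro matroid.expand) simp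
qed

theorem mainTheorem2:
  fixes m d i :: nat and CH :: "nat set set" and M :: "nat matroid"
  assumes "sparse_paving m d CH M"
  shows "coeff (KL_poly M) i \<le> coeff (KL_poly (uniform_matroid m d)) i"
proof (cases "\<exists>P :: nat matroid \<Rightarrow> int poly. KL_family P")
  case False
  then have "KL_poly M = KL_poly (uniform_matroid m d)" unfolding KL_poly_def by simp
  then show ?thesis by simp
next
  case True
  then obtain P :: "nat matroid \<Rightarrow> int poly" where P: "KL_family P" by blast
  let ?U = "uniform_matroid m d"
  have M: "is_matroid M" "rank M = d" and U: "is_matroid ?U" "rank ?U = d"
    using assms sparse_paving_uniform_matroid[of m d] unfolding sparse_paving_def by auto
  note spm = sparse_paving_eq_spm[OF assms]
  \<comment> \<open>For d = 1 a circuit-hyperplane is a loop, and rank 1 gives the polynomial 1 on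
    both sides; for m = 0 there are no circuit-hyperplanes.\<close>
  consider "d = 0" | "d = 1" | "m = 0" | "2 \<le> d" "1 \<le> m" by linarith
  then have "coeff (P M) i \<le> coeff (P ?U) i"
  proof cases
    case 1
    then show ?thesis using KL_family_rank_0[OF P] M U by simp
  next
    case 2
    then show ?thesis using KL_family_rank_1[OF P] M U by simp
  next
    case 3
    then show ?thesis using spm by (simp add: uniform_matroid_eq_spm)
  next
    case 4
    then have "sparse_family {1..m + d} d CH" by (intro sparse_paving_imp_sparse_family[OF assms]) auto
    from arg_cong[OF KL_uniform_minus_sparse_paving[OF P this 4(1)], of "\<lambda>p. coeff p i"]
    have "real_of_int (coeff (P ?U) i - coeff (P M) i) = real (card CH) * relax_coeff d i"
      unfolding uniform_matroid_eq_spm spm(1)[symmetric]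
      by (simp add: coeff_map_poly of_nat_poly coeff_relax_poly)
    moreover have "0 \<le> real (card CH) * relax_coeff d i" by (simp add: relax_coeff_nonneg)
    ultimately show ?thesis by linarith
  qed
  then show ?thesis using KL_poly_eq[OF P] M U by simp
qed

end
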